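(* Let $(G,u)$ be a concurrent game with state space $S$, and let $\Pi_1,\Pi_2$ be two partitions of $S$ such that $\Pi_2$ is a refinement of $\Pi_1$ and the lower and upper abstractions $(G_i^{\downarrow},u_i^{\downarrow})$, $(G_i^{\uparrow},u_i^{\uparrow})$ of $(G,u)$ with respect to $\Pi_i$ exist for $i=1,2$. Then the refinement property holds: for every $L\in\mathbb N$, $$\upsilon_{2L}(G_1^{\downarrow},u_1^{\downarrow})\le\upsilon_{2L}(G_2^{\downarrow},u_2^{\downarrow})\le\upsilon_{2L}(G_2^{\uparrow},u_2^{\uparrow})\le\upsilon_{2L}(G_1^{\uparrow},u_1^{\uparrow}).$$
   Context: **Concurrent games.** A concurrent two-player game structure is $G=(S,s_0,A,\Gamma_1,\Gamma_2,\delta)$, where $S$ is a finite set of states, $s_0\in S$ the start state, $A$ a finite set of actions, $\Gamma_1,\Gamma_2:S\to 2^A\setminus\{\emptyset\}$ give the actions available to each player at each state, and $\delta:S\times A\times A\to S$ is the transition function (relevant for $a_1\in\Gamma_1(s)$, $a_2\in\Gamma_2(s)$). A game $(G,u)$ is a game structure with a utility function $u:S\to\mathbb R$ for player 1, who maximizes; player 2 minimizes. A play is an infinite sequence $(s_i,a_1^i,a_2^i)_{i\ge0}$ starting at $s_0$ with $a_j^i\in\Gamma_j(s_i)$ and $s_{i+1}=\delta(s_i,a_1^i,a_2^i)$, actions being chosen simultaneously and independently. A history is a finite prefix of a play (a finite sequence of triples, possibly empty); $last(h)$ is the state reached after $h$ ($s_0$ for the empty history). A mixed strategy of player $i$ maps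 each history $h$ to a probability distribution supported in $\Gamma_i(last(h))$. A pair of mixed strategies induces a probability measure on plays, with expectation $\mathbb E^{(\sigma_1,\sigma_2)}$. For a play $p$, $u_L(p)=\sum_{i=0}^{L-1}u(s_i)$ is the utility of its prefix of length $L$, and the $L$-step finite-horizon value is $$\upsilon_L(G,u)=\sup_{\sigma_1}\inf_{\sigma_2}\mathbb E^{(\sigma_1,\sigma_2)}[u_L(p)],$$ over mixed strategies. **Refinement.** A partition $\Pi_2$ is a refinement of a partition $\Pi_1$, written $\Pi_2\sqsubseteq\Pi_1$, if every $\pi\in\Pi_1$ is a union of sets belonging to $\Pi_2$. **Abstractions.** Let $\Pi$ be a partition of $S$. The abstractions with respect to $\Pi$ exist if and only if any two states $s_1,s_2$ in the same set of $\Pi$ satisfy $\Gamma_1(s_1)=\Gamma_1(s_2)$ and $\Gamma_2(s_1)=\Gamma_2(s_2)$. In that case the lower abstraction $G^{\downarrow}=(S^{a},s_0^{a},A^{a},\Gamma_1^{\downarrow},\Gamma_2^{\downarrow},\delta^{\downarrow})$ and the upper abstraction $G^{\uparrow}=(S^{a},s_0^{a},A^{a},\Gamma_1^{\uparrow},\Gamma_2^{\uparrow},\delta^{\uparrow})$ are: - $S^{a}=\Pi\cup D$ with $D=\Pi\times A\times A$ (dummy states); $s_0^{a}\in\Pi$ is the set containing $s_0$; $A^{a}=A\cup\Pi$. - For $\pi\in\Pi$ and $i=1,2$: $\Gamma_i^{\downarrow}(\pi)=\Gamma_i^{\uparrow}(\pi)=\Gamma_i(s)$ for any $s\in\pi$;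 and $\delta^{\downarrow}(\pi,a_1,a_2)=\delta^{\uparrow}(\pi,a_1,a_2)=(\pi,a_1,a_2)\in D$ for available $a_1,a_2$. - For $d=(\pi,a_1,a_2)\in D$ let $X_d=\{\pi'\in\Pi:\exists s\in\pi,\ \delta(s,a_1,a_2)\in\pi'\}$. In $G^{\downarrow}$, $\Gamma_1^{\downarrow}(d)$ is a singleton (an arbitrary fixed action), $\Gamma_2^{\downarrow}(d)=X_d$, and $\delta^{\downarrow}(d,b_1,b_2)=b_2$. In $G^{\uparrow}$, $\Gamma_2^{\uparrow}(d)$ is a singleton, $\Gamma_1^{\uparrow}(d)=X_d$, and $\delta^{\uparrow}(d,b_1,b_2)=b_1$. - $u^{\downarrow}(\pi)=\min_{s\in\pi}u(s)$ and $u^{\uparrow}(\pi)=\max_{s\in\pi}u(s)$ for $\pi\in\Pi$; $u^{\downarrow}(d)=u^{\uparrow}(d)=0$ for $d\in D$. *)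

theory Defs
  imports "HOL-Probability.Probability"
begin

section \<open>Concurrent games\<close>

record ('s, 'a) game =
  states :: "'s set"
  start :: 's
  acts :: "'a set"
  avail1 :: "'s \<Rightarrow> 'a set"
  avail2 :: "'s \<Rightarrow> 'a set"
  trans :: "'s \<Rightarrow> 'a \<Rightarrow> 'a \<Rightarrow> 's"

definition concurrent_game :: "('s, 'a) game \<Rightarrow> bool" where
  "concurrent_game G \<longleftrightarrow>
     finite (states G) \<and> start G \<in> states G \<and> finite (acts G) \<and>
     (\<forall>s\<in>states G. avail1 G s \<subseteq> acts G \<and> avail1 G s \<noteq> {} \<and>
                   avail2 G s \<subseteq> acts G \<and> avail2 G s \<noteq> {}) \<and>
     (\<forall>s\<in>states G. \<forall>a\<in>acts G. \<forall>b\<in>acts G. trans G s a b \<in> states G)"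

type_synonym ('s, 'a) step = "'s \<times> 'a \<times> 'a"

definition is_play :: "('s, 'a) game \<Rightarrow> (nat \<Rightarrow> ('s, 'a) step) \<Rightarrow> bool" where
  "is_play G p \<longleftrightarrow>
     fst (p 0) = start G \<and>
     (\<forall>i. case p i of (s, a, b) \<Rightarrow>
        a \<in> avail1 G s \<and> b \<in> avail2 G s \<and> fst (p (Suc i)) = trans G s a b)"

definition histories :: "('s, 'a) game \<Rightarrow> ('s, 'a) step list set" where
  "histories G = {map p [0..<n] | p n. is_play G p}"

definition last_state :: "('s, 'a) game \<Rightarrow> ('s, 'a) step list \<Rightarrow> 's" where
  "last_state G h =
     (if h = [] then start G else case last h of (s, a, b) \<Rightarrow> trans G s a b)"

type_synonym ('s, 'a) strategy = "('s, 'a) step list \<Rightarrow> 'a pmf"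

definition strategies1 :: "('s, 'a) game \<Rightarrow> ('s, 'a) strategy set" where
  "strategies1 G = {\<sigma>. \<forall>h\<in>histories G. set_pmf (\<sigma> h) \<subseteq> avail1 G (last_state G h)}"

definition strategies2 :: "('s, 'a) game \<Rightarrow> ('s, 'a) strategy set" where
  "strategies2 G = {\<sigma>. \<forall>h\<in>histories G. set_pmf (\<sigma> h) \<subseteq> avail2 G (last_state G h)}"

section \<open>The probability measure on plays\<close>

text \<open>Lists that are not histories have probability zero, so the continuation chosen for them is
  irrelevant; a constant one keeps the kernel below measurable, because there are only
  finitely many histories of each length.\<close>

definition next_step ::
  "('s, 'a) game \<Rightarrow> ('s, 'a) strategy \<Rightarrow> ('s, 'a) strategy \<Rightarrow> ('s, 'a) step list \<Rightarrow> ('s, 'a) step pmf"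
where
  "next_step G \<sigma>\<^sub>1 \<sigma>\<^sub>2 h =
     (if h \<in> histories G
      then map_pmf (\<lambda>(a, b). (last_state G h, a, b)) (pair_pmf (\<sigma>\<^sub>1 h) (\<sigma>\<^sub>2 h))
      else return_pmf undefined)"

definition step_kernel ::
  "('s, 'a) game \<Rightarrow> ('s, 'a) strategy \<Rightarrow> ('s, 'a) strategy \<Rightarrow>
   nat \<Rightarrow> (nat \<Rightarrow> ('s, 'a) step) \<Rightarrow> ('s, 'a) step measure"
where
  "step_kernel G \<sigma>\<^sub>1 \<sigma>\<^sub>2 n p = measure_pmf (next_step G \<sigma>\<^sub>1 \<sigma>\<^sub>2 (map p [0..<n]))"

text \<open>The measure whose \<open>n\<close>-th coordinate is drawn from the kernel given the coordinates before
  \<open>n\<close>, by the theorem of Ionescu Tulcea. It lives on all sequences of steps and is concentrated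
  on the plays.\<close>

definition play_measure ::
  "('s, 'a) game \<Rightarrow> ('s, 'a) strategy \<Rightarrow> ('s, 'a) strategy \<Rightarrow> (nat \<Rightarrow> ('s, 'a) step) measure"
where
  "play_measure G \<sigma>\<^sub>1 \<sigma>\<^sub>2 =
     projective_family.lim UNIV
       (Ionescu_Tulcea.CI (step_kernel G \<sigma>\<^sub>1 \<sigma>\<^sub>2) (\<lambda>_. count_space UNIV))
       (\<lambda>_. count_space UNIV)"

section \<open>Finite-horizon values\<close>

definition utility_upto :: "('s \<Rightarrow> real) \<Rightarrow> nat \<Rightarrow> (nat \<Rightarrow> ('s, 'a) step) \<Rightarrow> real" where
  "utility_upto u L p = (\<Sum>i<L. u (fst (p i)))"

definition game_value :: "nat \<Rightarrow> ('s, 'a) game \<Rightarrow> ('s \<Rightarrow> real) \<Rightarrow> real" where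
  "game_value L G u =
     (SUP \<sigma>\<^sub>1\<in>strategies1 G. INF \<sigma>\<^sub>2\<in>strategies2 G.
        \<integral>p. utility_upto u L p \<partial>play_measure G \<sigma>\<^sub>1 \<sigma>\<^sub>2)"

section \<open>Partitions and abstractions\<close>

definition refinement :: "'s set set \<Rightarrow> 's set set \<Rightarrow> bool" where
  "refinement P\<^sub>2 P\<^sub>1 \<longleftrightarrow> (\<forall>\<pi>\<in>P\<^sub>1. \<exists>C\<subseteq>P\<^sub>2. \<pi> = \<Union>C)"

definition abstractions_exist :: "('s, 'a) game \<Rightarrow> 's set set \<Rightarrow> bool" where
  "abstractions_exist G P \<longleftrightarrow>
     (\<forall>\<pi>\<in>P. \<forall>s\<in>\<pi>. \<forall>t\<in>\<pi>. avail1 G s = avail1 G t \<and> avail2 G s = avail2 G t)"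

datatype ('s, 'a) abs_state = Block "'s set" | Dummy "'s set" 'a 'a

datatype ('s, 'a) abs_act = Act 'a | Goto "'s set"

definition dummies :: "('s, 'a) game \<Rightarrow> 's set set \<Rightarrow> ('s, 'a) abs_state set" where
  "dummies G P = {Dummy \<pi> a b | \<pi> a b. \<pi> \<in> P \<and> a \<in> acts G \<and> b \<in> acts G}"

definition abs_states :: "('s, 'a) game \<Rightarrow> 's set set \<Rightarrow> ('s, 'a) abs_state set" where
  "abs_states G P = Block ` P \<union> dummies G P"

definition abs_start :: "('s, 'a) game \<Rightarrow> 's set set \<Rightarrow> ('s, 'a) abs_state" where
  "abs_start G P = Block (THE \<pi>. \<pi> \<in> P \<and> start G \<in> \<pi>)"

definition abs_acts :: "('s, 'a) game \<Rightarrow> 's set set \<Rightarrow> ('s, 'a) abs_act set" where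
  "abs_acts G P = Act ` acts G \<union> Goto ` P"

definition successors ::
  "('s, 'a) game \<Rightarrow> 's set set \<Rightarrow> 's set \<Rightarrow> 'a \<Rightarrow> 'a \<Rightarrow> 's set set" where
  "successors G P \<pi> a b = {\<pi>'\<in>P. \<exists>s\<in>\<pi>. trans G s a b \<in> \<pi>'}"

text \<open>In a dummy state the passive player only has the action fixed by \<open>c\<close>, whereas the active
  player chooses the next block. The catch-all equations of the transition functions only
  concern unavailable actions.\<close>

definition block_avail :: "('s \<Rightarrow> 'a set) \<Rightarrow> 's set \<Rightarrow> ('s, 'a) abs_act set" where
  "block_avail \<Gamma> \<pi> = Act ` \<Gamma> (SOME s. s \<in> \<pi>)"

fun passive_avail ::
  "('s \<Rightarrow> 'a set) \<Rightarrow> (('s, 'a) abs_state \<Rightarrow> ('s, 'a) abs_act) \<Rightarrow>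
   ('s, 'a) abs_state \<Rightarrow> ('s, 'a) abs_act set"
where
  "passive_avail \<Gamma> c (Block \<pi>) = block_avail \<Gamma> \<pi>"
| "passive_avail \<Gamma> c (Dummy \<pi> a b) = {c (Dummy \<pi> a b)}"

fun active_avail ::
  "('s, 'a) game \<Rightarrow> 's set set \<Rightarrow> ('s \<Rightarrow> 'a set) \<Rightarrow>
   ('s, 'a) abs_state \<Rightarrow> ('s, 'a) abs_act set"
where
  "active_avail G P \<Gamma> (Block \<pi>) = block_avail \<Gamma> \<pi>"
| "active_avail G P \<Gamma> (Dummy \<pi> a b) = Goto ` successors G P \<pi> a b"

fun lower_trans ::
  "('s, 'a) abs_state \<Rightarrow> ('s, 'a) abs_act \<Rightarrow> ('s, 'a) abs_act \<Rightarrow> ('s, 'a) abs_state"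
where
  "lower_trans (Block \<pi>) (Act a) (Act b) = Dummy \<pi> a b"
| "lower_trans (Dummy \<pi> a b) _ (Goto \<pi>') = Block \<pi>'"
| "lower_trans x _ _ = x"

fun upper_trans ::
  "('s, 'a) abs_state \<Rightarrow> ('s, 'a) abs_act \<Rightarrow> ('s, 'a) abs_act \<Rightarrow> ('s, 'a) abs_state"
where
  "upper_trans (Block \<pi>) (Act a) (Act b) = Dummy \<pi> a b"
| "upper_trans (Dummy \<pi> a b) (Goto \<pi>') _ = Block \<pi>'"
| "upper_trans x _ _ = x"

text \<open>The admissible ways of fixing the forced action in the dummy states.\<close>

definition dummy_choice ::
  "('s, 'a) game \<Rightarrow> 's set set \<Rightarrow> (('s, 'a) abs_state \<Rightarrow> ('s, 'a) abs_act) \<Rightarrow> bool" where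
  "dummy_choice G P c \<longleftrightarrow> (\<forall>d\<in>dummies G P. c d \<in> abs_acts G P)"

definition lower_abstraction ::
  "('s, 'a) game \<Rightarrow> 's set set \<Rightarrow> (('s, 'a) abs_state \<Rightarrow> ('s, 'a) abs_act) \<Rightarrow>
   (('s, 'a) abs_state, ('s, 'a) abs_act) game"
where
  "lower_abstraction G P c =
     \<lparr>states = abs_states G P, start = abs_start G P, acts = abs_acts G P,
      avail1 = passive_avail (avail1 G) c, avail2 = active_avail G P (avail2 G),
      trans = lower_trans\<rparr>"

definition upper_abstraction ::
  "('s, 'a) game \<Rightarrow> 's set set \<Rightarrow> (('s, 'a) abs_state \<Rightarrow> ('s, 'a) abs_act) \<Rightarrow>
   (('s, 'a) abs_state, ('s, 'a) abs_act) game"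
where
  "upper_abstraction G P c =
     \<lparr>states = abs_states G P, start = abs_start G P, acts = abs_acts G P,
      avail1 = active_avail G P (avail1 G), avail2 = passive_avail (avail2 G) c,
      trans = upper_trans\<rparr>"

fun lower_utility :: "('s \<Rightarrow> real) \<Rightarrow> ('s, 'a) abs_state \<Rightarrow> real" where
  "lower_utility u (Block \<pi>) = Min (u ` \<pi>)"
| "lower_utility u (Dummy \<pi> a b) = 0"

fun upper_utility :: "('s \<Rightarrow> real) \<Rightarrow> ('s, 'a) abs_state \<Rightarrow> real" where
  "upper_utility u (Block \<pi>) = Max (u ` \<pi>)"
| "upper_utility u (Dummy \<pi> a b) = 0"

end

theory Submission
  imports Defs
begin

text \<open>Against a fixed strategy of player 1, player 2 may answer with pure actions, so the sup-inf
  value of every game is given by backward induction, where one stage contributes the supremum over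
  mixed actions of player 1 of the minimum over actions of player 2; no minimax theorem is needed.
  In an abstraction two steps form a round: one stage at a block, then a minimum (lower) or a
  maximum (upper) over the successor blocks. A block contained in a coarser one has the same
  actions, a larger minimal and a smaller maximal utility, and each of its successors is contained
  in a successor of the coarser block, so all three inequalities follow by induction on the number
  of rounds.\<close>

section \<open>Histories\<close>

text \<open>\<open>game_value\<close> integrates over infinite sequences of steps, whereas backward
  induction only sees finite prefixes. The bridge between them is that each length has only finitely
  many histories: the kernel of each step then takes finitely many values, and the utility up to a
  fixed horizon is almost surely constant on each of finitely many cylinders. A minimax theorem is
  avoidable because \<open>game_value\<close> and the stage values both keep the supremum of player
  1 outside, so the two players are never exchanged. That supremum is only approached, not shown to
  be attained, so a near-optimal strategy loses a small amount at every stage. The induction on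
  rounds has a hypothesis about blocks only, because containment of blocks is what relates two
  partitions; dummy states are unfolded inside a round.\<close>

lemma last_state_snoc [simp]: "last_state G (h @ [(s, a, b)]) = trans G s a b"
  by (simp add: last_state_def)

lemma last_state_Nil [simp]: "last_state G [] = start G"
  by (simp add: last_state_def)

lemma last_state_play_prefix:
  assumes "is_play G p"
  shows "last_state G (map p [0..<n]) = fst (p n)"
proof (cases n)
  case 0
  then show ?thesis using assms by (simp add: is_play_def)
next
  case (Suc m)
  obtain s a b where "p m = (s, a, b)" by (cases "p m")
  then show ?thesis using assms Suc by (force simp: is_play_def dest: spec[of _ m])
qed

lemma map_upt_eq_iff: "length h = n \<Longrightarrow> map p [0..<n] = h \<longleftrightarrow> (\<forall>i<n. p i = h ! i)"
  by (auto simp: list_eq_iff_nth_eq)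

text \<open>Fixing a prefix amounts to fixing finitely many coordinates, so the event is a finite
  box, hence visible to the product sigma-algebra.\<close>

lemma map_upt_cylinder:
  assumes "length h = n"
  shows "{p \<in> space (PiM {0..<n} (\<lambda>_. count_space UNIV)). map p [0..<n] = h} = PiE {0..<n} (\<lambda>i. {h ! i})"
  unfolding map_upt_eq_iff[OF assms] by (auto simp: space_PiM PiE_iff extensional_def)

context
  fixes G :: "('s, 'a) game"
  assumes G: "concurrent_game G"
begin

lemma finite_avail1: "s \<in> states G \<Longrightarrow> finite (avail1 G s)"
  and finite_avail2: "s \<in> states G \<Longrightarrow> finite (avail2 G s)"
  and avail1_nonempty: "s \<in> states G \<Longrightarrow> avail1 G s \<noteq> {}"
  and avail2_nonempty: "s \<in> states G \<Longrightarrow> avail2 G s \<noteq> {}"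
  using G by (auto simp: concurrent_game_def intro: finite_subset)

lemma trans_in_states:
  "s \<in> states G \<Longrightarrow> a \<in> avail1 G s \<Longrightarrow> b \<in> avail2 G s \<Longrightarrow> trans G s a b \<in> states G"
  using G unfolding concurrent_game_def by blast

lemma play_in_states:
  assumes "is_play G p"
  shows "p n \<in> states G \<times> acts G \<times> acts G"
proof -
  have av: "case p i of (s, a, b) \<Rightarrow>
        a \<in> avail1 G s \<and> b \<in> avail2 G s \<and> fst (p (Suc i)) = trans G s a b" for i
    using assms by (simp add: is_play_def)
  have st: "fst (p n) \<in> states G"
  proof (induction n)
    case 0
    then show ?case using assms G by (simp add: is_play_def concurrent_game_def)
  next
    case (Suc n)
    then show ?case using av[of n] trans_in_states by (auto split: prod.splits)
  qed
  then show ?thesis using av[of n] G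
    unfolding concurrent_game_def by (cases "p n") auto
qed

lemma last_state_in_states: "h \<in> histories G \<Longrightarrow> last_state G h \<in> states G"
  using play_in_states by (force simp: histories_def last_state_play_prefix mem_Times_iff)

lemma set_history:
  assumes "h \<in> histories G"
  shows "set h \<subseteq> states G \<times> acts G \<times> acts G"
proof -
  obtain p n where "is_play G p" "h = map p [0..<n]"
    using assms by (auto simp: histories_def)
  then show ?thesis using play_in_states by (simp only: set_map image_subset_iff) blast
qed

text \<open>This finiteness makes the step kernel measurable and gives the law of a play prefix
  finite support.\<close>

lemma finite_histories: "finite {h \<in> histories G. length h = n}"
proof (rule finite_subset)
  show "{h \<in> histories G. length h = n} \<subseteq> {h. set h \<subseteq> states G \<times> acts G \<times> acts G \<and> length h = n}"
    using set_history by blast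
  show "finite {h. set h \<subseteq> states G \<times> acts G \<times> acts G \<and> length h = n}"
    using G by (intro finite_lists_length_eq) (simp add: concurrent_game_def)
qed

text \<open>A history is by definition a prefix of an infinite play, so even a one-step extension of
  a history needs an infinite continuation. It is obtained by iterating arbitrary legal moves, which
  exist because the action sets are nonempty; \<open>s\<close> is any state, so that the
  continuation can be glued to a prefix.\<close>

lemma exists_play_from:
  assumes "s \<in> states G" "a \<in> avail1 G s" "b \<in> avail2 G s"
  shows "\<exists>q. q 0 = (s, a, b) \<and> (\<forall>i. case q i of (s, a, b) \<Rightarrow>
        a \<in> avail1 G s \<and> b \<in> avail2 G s \<and> fst (q (Suc i)) = trans G s a b)"
proof -
  define nxt where "nxt = (\<lambda>(s, a, b). let t = trans G s a b in
    (t, SOME a. a \<in> avail1 G t, SOME b. b \<in> avail2 G t))"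
  define ok where "ok = (\<lambda>(s, a, b). s \<in> states G \<and> a \<in> avail1 G s \<and> b \<in> avail2 G s)"
  have ok_nxt: "ok (nxt x)" if "ok x" for x
    using that trans_in_states avail1_nonempty avail2_nonempty
    by (auto simp: ok_def nxt_def Let_def some_in_eq split: prod.splits)
  have ok: "ok ((nxt ^^ i) (s, a, b))" for i
    by (induction i) (auto simp: ok_nxt, auto simp: ok_def assms)
  have step: "case x of (s, a, b) \<Rightarrow> a \<in> avail1 G s \<and> b \<in> avail2 G s \<and>
      fst (nxt x) = trans G s a b" if "ok x" for x
    using that by (auto simp: ok_def nxt_def Let_def)
  show ?thesis
    using step[OF ok] by (intro exI[of _ "\<lambda>i. (nxt ^^ i) (s, a, b)"]) simp
qed

lemma Nil_in_histories: "[] \<in> histories G"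
proof -
  have s: "start G \<in> states G" using G by (simp add: concurrent_game_def)
  obtain a b where "a \<in> avail1 G (start G)" "b \<in> avail2 G (start G)"
    using avail1_nonempty[OF s] avail2_nonempty[OF s] by auto
  from exists_play_from[OF s this] have "\<exists>q. is_play G q"
    by (rule ex_forward) (simp add: is_play_def)
  then show ?thesis by (force simp: histories_def)
qed

lemma history_snoc:
  assumes "h \<in> histories G" "a \<in> avail1 G (last_state G h)" "b \<in> avail2 G (last_state G h)"
  shows "h @ [(last_state G h, a, b)] \<in> histories G"
proof -
  obtain p n where p: "is_play G p" and h: "h = map p [0..<n]"
    using assms(1) by (auto simp: histories_def)
  obtain q where q0: "q 0 = (last_state G h, a, b)" and q: "\<And>i. case q i of (s, a, b) \<Rightarrow>
      a \<in> avail1 G s \<and> b \<in> avail2 G s \<and> fst (q (Suc i)) = trans G s a b"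
    using exists_play_from[OF last_state_in_states] assms by blast
  have q0': "fst (q 0) = fst (p n)"
    using q0 p by (simp add: h last_state_play_prefix)
  define r where "r i = (if i < n then p i else q (i - n))" for i
  have "is_play G r"
    unfolding is_play_def
  proof (intro conjI allI)
    show "fst (r 0) = start G"
      using p q0' by (auto simp: r_def is_play_def)
    fix i
    \<comment> \<open>The case \<open>Suc i = n\<close> is the seam: \<open>p\<close> prescribes the
      state \<open>fst (p n)\<close> there, and \<open>q\<close> starts in exactly that
      state.\<close>
    consider "i \<ge> n" | "Suc i = n" | "Suc i < n" by linarith
    then show "case r i of (s, a, b) \<Rightarrow>
        a \<in> avail1 G s \<and> b \<in> avail2 G s \<and> fst (r (Suc i)) = trans G s a b"
    proof cases
      case 1
      then show ?thesis using q[of "i - n"] by (simp add: r_def Suc_diff_le)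
    next
      case 2
      then show ?thesis using p q0' by (auto simp: r_def is_play_def dest: spec[of _ i])
    next
      case 3
      then show ?thesis using p by (auto simp: r_def is_play_def dest: spec[of _ i])
    qed
  qed
  moreover have "h @ [(last_state G h, a, b)] = map r [0..<Suc n]"
    using q0 by (auto simp: h r_def)
  ultimately show ?thesis by (auto simp: histories_def simp del: upt_Suc)
qed

end

section \<open>The law of finite play prefixes\<close>

primrec history_pmf ::
  "('s, 'a) game \<Rightarrow> ('s, 'a) strategy \<Rightarrow> ('s, 'a) strategy \<Rightarrow> nat \<Rightarrow> ('s, 'a) step list pmf" where
  "history_pmf G \<sigma> \<tau> 0 = return_pmf []"
| "history_pmf G \<sigma> \<tau> (Suc n) =
     bind_pmf (history_pmf G \<sigma> \<tau> n) (\<lambda>h. map_pmf (\<lambda>x. h @ [x]) (next_step G \<sigma> \<tau> h))"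

text \<open>This is the conditional expectation of the utility of the next \<open>n\<close> steps
  after the prefix \<open>h\<close>. The recursion peels off the earliest step, as backward
  induction does, whereas \<open>history_pmf\<close> appends the latest one.\<close>

primrec payoff ::
  "('s, 'a) game \<Rightarrow> ('s \<Rightarrow> real) \<Rightarrow> ('s, 'a) strategy \<Rightarrow> ('s, 'a) strategy \<Rightarrow>
   nat \<Rightarrow> ('s, 'a) step list \<Rightarrow> real" where
  "payoff G u \<sigma> \<tau> 0 h = 0"
| "payoff G u \<sigma> \<tau> (Suc n) h =
     u (last_state G h) + (\<integral>x. payoff G u \<sigma> \<tau> n (h @ [x]) \<partial>next_step G \<sigma> \<tau> h)"

text \<open>A nonempty list splits uniquely into its front and its last entry, so only the front
  \<open>h\<close> contributes to the mixture.\<close>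

lemma pmf_history_pmf_snoc:
  "pmf (history_pmf G \<sigma> \<tau> (Suc n)) (h @ [x]) =
     pmf (history_pmf G \<sigma> \<tau> n) h * pmf (next_step G \<sigma> \<tau> h) x"
proof -
  have *: "pmf (map_pmf (\<lambda>x. h' @ [x]) (next_step G \<sigma> \<tau> h')) (h @ [x]) =
      (if h' = h then pmf (next_step G \<sigma> \<tau> h) x else 0)" for h'
  proof (cases "h' = h")
    case True
    then show ?thesis using pmf_map_inj'[of "\<lambda>x. h @ [x]" "next_step G \<sigma> \<tau> h" x]
      by (simp add: inj_def)
  next
    case False
    then show ?thesis by (simp add: pmf_eq_0_set_pmf image_iff)
  qed
  show ?thesis
    by (simp add: pmf_bind *) (subst integral_measure_pmf[of "{h}"], auto split: if_splits)
qed

context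
  fixes G :: "('s, 'a) game" and \<sigma> \<tau> :: "('s, 'a) strategy"
  assumes G: "concurrent_game G"
begin

text \<open>A product of discrete sigma-algebras over a large type need not be discrete, so
  measurability is not automatic. The kernel factors through the map \<open>r\<close> into a finite
  set: it keeps a prefix that is a history and sends all others, which share one continuation, to
  \<open>None\<close>. The fibres of \<open>r\<close> are boxes and the complement of a finite union
  of boxes.\<close>

lemma step_kernel_measurable:
  "step_kernel G \<sigma> \<tau> n \<in>
     PiM {0..<n} (\<lambda>_. count_space UNIV) \<rightarrow>\<^sub>M subprob_algebra (count_space UNIV)"
    (is "_ \<in> ?M \<rightarrow>\<^sub>M ?S")
proof -
  define H where "H = {h \<in> histories G. length h = n}"
  define r where "r p = (if map p [0..<n] \<in> H then Some (map p [0..<n]) else None)"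
    for p :: "nat \<Rightarrow> ('s, 'a) step"
  define g where "g = (\<lambda>x. measure_pmf (case x of Some h \<Rightarrow> next_step G \<sigma> \<tau> h
    | None \<Rightarrow> return_pmf undefined))"
  have fin: "finite H" unfolding H_def by (rule finite_histories[OF G])
  have cyl: "{p \<in> space ?M. map p [0..<n] = h} \<in> sets ?M" if "h \<in> H" for h
  proof -
    have "length h = n" using that by (simp add: H_def)
    then show ?thesis unfolding map_upt_cylinder[OF \<open>length h = n\<close>] by (simp add: sets_PiM_I_finite)
  qed
  have Some_vimage: "r -` {Some h} \<inter> space ?M = {p \<in> space ?M. map p [0..<n] = h}" if "h \<in> H" for h
    using that by (auto simp: r_def split: if_splits)
  have None_vimage: "r -` {None} \<inter> space ?M = space ?M - (\<Union>h\<in>H. {p \<in> space ?M. map p [0..<n] = h})"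
    by (simp add: set_eq_iff r_def)
  have "r -` {x} \<inter> space ?M \<in> sets ?M" if "x \<in> insert None (Some ` H)" for x
  proof (cases x)
    case None
    show ?thesis unfolding None None_vimage
      by (intro sets.Diff sets.top sets.finite_UN fin cyl)
  next
    case (Some h)
    then have "h \<in> H" using that by auto
    then show ?thesis unfolding Some by (simp only: Some_vimage cyl)
  qed
  moreover have "r x \<in> insert None (Some ` H)" for x
    by (simp add: r_def)
  ultimately have "r \<in> ?M \<rightarrow>\<^sub>M count_space (insert None (Some ` H))"
    using measurable_count_space_eq2[of "insert None (Some ` H)" r ?M] fin
    by (simp add: Pi_def del: insert_iff)
  moreover have "g \<in> count_space (insert None (Some ` H)) \<rightarrow>\<^sub>M ?S"
    by (simp add: g_def measure_pmf_in_subprob_algebra)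
  moreover have "step_kernel G \<sigma> \<tau> n = (\<lambda>p. g (r p))"
    by (rule ext) (simp add: step_kernel_def g_def r_def H_def next_step_def)
  ultimately show ?thesis by (simp add: measurable_compose)
qed

lemma Ionescu_Tulcea_step_kernel:
  "Ionescu_Tulcea (step_kernel G \<sigma> \<tau>) (\<lambda>_. count_space UNIV)"
  by (rule Ionescu_Tulcea.intro)
    (simp_all add: step_kernel_measurable step_kernel_def measure_pmf.prob_space_axioms)

interpretation IT: Ionescu_Tulcea "step_kernel G \<sigma> \<tau>" "\<lambda>_. count_space UNIV"
  by (rule Ionescu_Tulcea_step_kernel)

text \<open>\<open>IT.C 0 n\<close> is the law of the first \<open>n\<close> coordinates, started
  from the only point of the empty product. It and \<open>history_pmf\<close> obey the same one-step
  recursion on single prefixes.\<close>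

lemma emeasure_C_cylinder:
  assumes "length h = n"
  shows "emeasure (IT.C 0 n (\<lambda>_. undefined)) (PiE {0..<n} (\<lambda>i. {h ! i})) =
    ennreal (pmf (history_pmf G \<sigma> \<tau> n) h)"
  using assms
proof (induction n arbitrary: h)
  case 0
  then show ?case by (simp add: PiM_empty)
next
  case (Suc n)
  then obtain h' x where h: "h = h' @ [x]" and len: "length h' = n"
    by (metis length_Suc_conv_rev)
  let ?M = "\<lambda>n. PiM {0..<n} (\<lambda>_. count_space UNIV) :: (nat \<Rightarrow> ('s, 'a) step) measure"
  let ?X = "\<lambda>n h. PiE {0..<n} (\<lambda>i. {h ! i}) :: (nat \<Rightarrow> ('s, 'a) step) set"
  let ?C = "IT.C 0 n (\<lambda>_. undefined)"
  have [measurable]: "?X n h \<in> sets (?M n)" for n h by (simp add: sets_PiM_I_finite)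
  have space: "space ?C = space (?M n)" using IT.space_C[of _ 0 n] by simp
  have sets: "sets ?C = sets (?M n)" using IT.sets_C[of _ 0 n] by simp
  \<comment> \<open>Appending a coordinate to \<omega> lands in the box of \<open>h' @ [x]\<close>
    exactly if \<omega> lies in the box of \<open>h'\<close> and the new coordinate is
    \<open>x\<close>. Points of the finite product are \<open>undefined\<close> from
    \<open>n\<close> on, so the updated function has the right domain.\<close>
  have eP: "emeasure (IT.eP n \<omega>) (?X (Suc n) h) =
      ennreal (pmf (next_step G \<sigma> \<tau> h') x) * indicator (?X n h') \<omega>"
    if \<omega>: "\<omega> \<in> space (?M n)" for \<omega>
  proof -
    have ext: "\<omega> i = undefined" if "\<not> i < n" for i
      using \<omega> that by (auto simp: space_PiM PiE_iff extensional_def)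
    have "h ! n = x" and "h ! i = h' ! i" if "i < n" for i
      using len that by (simp_all add: h nth_append)
    then have "fun_upd \<omega> n y \<in> ?X (Suc n) h \<longleftrightarrow> \<omega> \<in> ?X n h' \<and> y = x" for y
      using ext len by (auto simp: PiE_iff extensional_def less_Suc_eq h nth_append)
    then have "fun_upd \<omega> n -` ?X (Suc n) h = (if \<omega> \<in> ?X n h' then {x} else {})"
      by auto
    moreover have "map \<omega> [0..<n] = h'" if "\<omega> \<in> ?X n h'"
      using that len by (simp add: map_upt_eq_iff PiE_iff)
    ultimately show ?thesis
      using \<omega> by (subst IT.emeasure_eP)
        (auto simp: step_kernel_def emeasure_pmf_single)
  qed
  have "emeasure (IT.C 0 (Suc n) (\<lambda>_. undefined)) (?X (Suc n) h) =
      (\<integral>\<^sup>+\<omega>. emeasure (IT.eP n \<omega>) (?X (Suc n) h) \<partial>?C)"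
    using IT.measurable_eP[of n]
    by (simp, subst emeasure_bind[where N = "?M (Suc n)"])
      (auto simp: space measurable_cong_sets[OF sets refl])
  also have "\<dots> = (\<integral>\<^sup>+\<omega>. ennreal (pmf (next_step G \<sigma> \<tau> h') x) * indicator (?X n h') \<omega> \<partial>?C)"
    by (intro nn_integral_cong eP) (simp add: space)
  also have "\<dots> = ennreal (pmf (next_step G \<sigma> \<tau> h') x) * ennreal (pmf (history_pmf G \<sigma> \<tau> n) h')"
    by (simp add: nn_integral_cmult_indicator sets Suc.IH[OF len])
  finally show ?case
    by (simp add: h pmf_history_pmf_snoc ennreal_mult mult.commute del: history_pmf.simps)
qed

lemma space_play_measure: "space (play_measure G \<sigma> \<tau>) = UNIV"
  and sets_play_measure: "sets (play_measure G \<sigma> \<tau>) = sets (PiM UNIV (\<lambda>_. count_space UNIV))"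
  by (simp_all add: play_measure_def space_PiM)

text \<open>A projective limit has the prescribed finite-dimensional marginals, and the marginal on
  the coordinates below \<open>n\<close> is \<open>IT.C 0 n\<close>.\<close>

lemma play_measure_cylinder:
  assumes "length h = n"
  shows "{p. map p [0..<n] = h} \<in> sets (play_measure G \<sigma> \<tau>)"
    and "emeasure (play_measure G \<sigma> \<tau>) {p. map p [0..<n] = h} =
      ennreal (pmf (history_pmf G \<sigma> \<tau> n) h)"
proof -
  let ?X = "PiE {0..<n} (\<lambda>i. {h ! i}) :: (nat \<Rightarrow> ('s, 'a) step) set"
  have X: "?X \<in> sets (PiM {0..<n} (\<lambda>_. count_space UNIV))" by (simp add: sets_PiM_I_finite)
  have emb: "{p. map p [0..<n] = h} = prod_emb UNIV (\<lambda>_. count_space UNIV) {0..<n} ?X"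
    unfolding map_upt_eq_iff[OF assms] by (auto simp: prod_emb_def PiE_iff)
  show "{p. map p [0..<n] = h} \<in> sets (play_measure G \<sigma> \<tau>)"
    unfolding emb sets_play_measure using X by (intro measurable_prod_emb) auto
  show "emeasure (play_measure G \<sigma> \<tau>) {p. map p [0..<n] = h} =
      ennreal (pmf (history_pmf G \<sigma> \<tau> n) h)"
    unfolding emb play_measure_def
    using IT.lim[of "{0..<n}", OF _ X] IT.emeasure_CI[OF _ X, of n] emeasure_C_cylinder[OF assms] X
    by (simp add: prod_emb_id sets.sets_into_space)
qed

end

lemma sum_list_map_upt_utility:
  "(\<Sum>x\<leftarrow>map p [0..<n]. u (fst x)) = utility_upto u n p"
  by (simp add: utility_upto_def interv_sum_list_conv_sum_set_nat atLeast0LessThan comp_def)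

section \<open>Expected utility as a finite recursion\<close>

context
  fixes G :: "('s, 'a) game" and \<sigma> \<tau> :: "('s, 'a) strategy"
  assumes G: "concurrent_game G" and \<sigma>: "\<sigma> \<in> strategies1 G" and \<tau>: "\<tau> \<in> strategies2 G"
begin

lemma set_strategies:
  assumes "h \<in> histories G"
  shows "set_pmf (\<sigma> h) \<subseteq> avail1 G (last_state G h)" "set_pmf (\<tau> h) \<subseteq> avail2 G (last_state G h)"
  using \<sigma> \<tau> assms by (auto simp: strategies1_def strategies2_def)

lemma set_next_step:
  assumes "h \<in> histories G"
  shows "set_pmf (next_step G \<sigma> \<tau> h) \<subseteq>
    (\<lambda>(a, b). (last_state G h, a, b)) ` (avail1 G (last_state G h) \<times> avail2 G (last_state G h))"
  using set_strategies[OF assms] assms by (auto simp: next_step_def)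

lemma finite_set_next_step: "h \<in> histories G \<Longrightarrow> finite (set_pmf (next_step G \<sigma> \<tau> h))"
  using last_state_in_states[OF G] finite_avail1[OF G] finite_avail2[OF G]
  by (intro finite_subset[OF set_next_step]) auto

lemma snoc_next_step_in_histories:
  assumes "h \<in> histories G" "x \<in> set_pmf (next_step G \<sigma> \<tau> h)"
  shows "h @ [x] \<in> histories G"
  using set_next_step[OF assms(1)] assms history_snoc[OF G assms(1)] by auto

text \<open>The default continuation in \<open>next_step\<close> is therefore never reached with
  positive probability.\<close>

lemma set_history_pmf: "set_pmf (history_pmf G \<sigma> \<tau> n) \<subseteq> {h \<in> histories G. length h = n}"
  by (induction n) (auto simp: Nil_in_histories[OF G] intro: snoc_next_step_in_histories)

lemma finite_set_history_pmf: "finite (set_pmf (history_pmf G \<sigma> \<tau> n))"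
  by (rule finite_subset[OF set_history_pmf finite_histories[OF G]])

text \<open>The cylinder of the empty prefix consists of all sequences, and
  \<open>history_pmf\<close> at length 0 is the point mass at \<open>[]\<close>.\<close>

lemma prob_space_play_measure: "prob_space (play_measure G \<sigma> \<tau>)"
  using play_measure_cylinder(2)[OF G, of "[]" 0 \<sigma> \<tau>]
  by (intro prob_spaceI) (simp add: space_play_measure[OF G])

lemma integral_utility_upto_eq_history_pmf:
  "(\<integral>p. utility_upto u n p \<partial>play_measure G \<sigma> \<tau>) =
     (\<integral>h. (\<Sum>x\<leftarrow>h. u (fst x)) \<partial>history_pmf G \<sigma> \<tau> n)"
proof -
  let ?M = "play_measure G \<sigma> \<tau>" and ?S = "set_pmf (history_pmf G \<sigma> \<tau> n)"
  let ?A = "\<lambda>h. {p. map p [0..<n] = h}" and ?w = "\<lambda>h :: ('s, 'a) step list. \<Sum>x\<leftarrow>h. u (fst x)"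
  interpret M: prob_space ?M by (rule prob_space_play_measure)
  have A[measurable]: "?A h \<in> sets ?M" and prob_A: "M.prob (?A h) = pmf (history_pmf G \<sigma> \<tau> n) h"
    if "h \<in> ?S" for h
  proof -
    have len: "length h = n" using that set_history_pmf by auto
    show "?A h \<in> sets ?M" by (rule play_measure_cylinder(1)[OF G len])
    show "M.prob (?A h) = pmf (history_pmf G \<sigma> \<tau> n) h"
      using play_measure_cylinder(2)[OF G len] by (simp add: measure_def)
  qed
  \<comment> \<open>The finitely many cylinders of possible prefixes are disjoint and their masses
    sum to 1, so almost every sequence lies in one of them; there the utility depends on the prefix
    alone.\<close>
  have "M.prob (\<Union>h\<in>?S. ?A h) = (\<Sum>h\<in>?S. M.prob (?A h))"
    using A by (intro M.finite_measure_finite_Union finite_set_history_pmf)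
      (auto simp: disjoint_family_on_def)
  also have "\<dots> = 1"
    using finite_set_history_pmf by (simp add: prob_A sum_pmf_eq_1)
  finally have ae: "AE p in ?M. map p [0..<n] \<in> ?S"
    by (rule AE_mp[OF M.AE_prob_1]) auto
  have [measurable]: "(\<lambda>p. u (fst (p i))) \<in> borel_measurable ?M" for i
  proof -
    have "(\<lambda>p. p i) \<in> ?M \<rightarrow>\<^sub>M count_space UNIV"
      unfolding measurable_cong_sets[OF sets_play_measure[OF G] refl] by simp
    then show ?thesis by (rule measurable_compose) simp
  qed
  have "(\<integral>p. utility_upto u n p \<partial>?M) = (\<integral>p. (\<Sum>h\<in>?S. ?w h * indicator (?A h) p) \<partial>?M)"
  proof (rule integral_cong_AE)
    show "AE p in ?M. utility_upto u n p = (\<Sum>h\<in>?S. ?w h * indicator (?A h) p)"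
      using ae
    proof eventually_elim
      case (elim p)
      then have "(\<Sum>h\<in>?S. ?w h * indicator (?A h) p) = ?w (map p [0..<n])"
        using finite_set_history_pmf
        by (subst sum.remove[of _ "map p [0..<n]"]) (auto simp: indicator_def intro!: sum.neutral)
      then show ?case by (simp only: sum_list_map_upt_utility)
    qed
  qed (auto simp: utility_upto_def)
  also have "\<dots> = (\<Sum>h\<in>?S. ?w h * M.prob (?A h))"
    using A by (subst Bochner_Integration.integral_sum) (auto simp: less_top[symmetric])
  also have "\<dots> = (\<integral>h. ?w h \<partial>history_pmf G \<sigma> \<tau> n)"
    using finite_set_history_pmf by (simp add: prob_A integral_measure_pmf[of ?S] mult.commute)
  finally show ?thesis .
qed

text \<open>Interpolates between the two recursions: \<open>n\<close> steps are drawn by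
  \<open>history_pmf\<close> and the remaining \<open>m\<close> are evaluated by
  \<open>payoff\<close>. For \<open>m = 0\<close> the left side is the expected utility of a prefix;
  the induction moves one step at a time from the first account to the second, which is why
  \<open>m\<close> varies.\<close>

lemma integral_history_pmf_payoff:
  "(\<integral>h. (\<Sum>x\<leftarrow>h. u (fst x)) + payoff G u \<sigma> \<tau> m h \<partial>history_pmf G \<sigma> \<tau> n) =
     payoff G u \<sigma> \<tau> (m + n) []"
proof (induction n arbitrary: m)
  case 0
  then show ?case by simp
next
  case (Suc n)
  let ?w = "\<lambda>h :: ('s, 'a) step list. \<Sum>x\<leftarrow>h. u (fst x)"
  have step: "(\<integral>x. ?w (h @ [x]) + payoff G u \<sigma> \<tau> m (h @ [x]) \<partial>next_step G \<sigma> \<tau> h) =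
      ?w h + payoff G u \<sigma> \<tau> (Suc m) h" if "h \<in> histories G" for h
  proof -
    have "(\<integral>x. ?w (h @ [x]) + payoff G u \<sigma> \<tau> m (h @ [x]) \<partial>next_step G \<sigma> \<tau> h) =
        (\<integral>x. (?w h + u (last_state G h)) + payoff G u \<sigma> \<tau> m (h @ [x]) \<partial>next_step G \<sigma> \<tau> h)"
      using set_next_step[OF that] by (intro integral_cong_AE) (auto simp: AE_measure_pmf_iff)
    also have "\<dots> = ?w h + payoff G u \<sigma> \<tau> (Suc m) h"
      using finite_set_next_step[OF that]
      by (subst Bochner_Integration.integral_add) (auto intro: integrable_measure_pmf_finite)
    finally show ?thesis .
  qed
  have "(\<integral>h. ?w h + payoff G u \<sigma> \<tau> m h \<partial>history_pmf G \<sigma> \<tau> (Suc n)) =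
      (\<integral>h. (\<integral>x. ?w (h @ [x]) + payoff G u \<sigma> \<tau> m (h @ [x]) \<partial>next_step G \<sigma> \<tau> h)
        \<partial>history_pmf G \<sigma> \<tau> n)"
    unfolding history_pmf.simps
    using finite_set_history_pmf[of n] set_history_pmf[of n] finite_set_next_step
    by (subst pmf_expectation_bind[where A = "set_pmf (history_pmf G \<sigma> \<tau> n)"])
      (auto simp: integral_measure_pmf[of "set_pmf (history_pmf G \<sigma> \<tau> n)"])
  also have "\<dots> = (\<integral>h. ?w h + payoff G u \<sigma> \<tau> (Suc m) h \<partial>history_pmf G \<sigma> \<tau> n)"
    using set_history_pmf[of n] by (intro integral_cong_AE AE_pmfI step) auto
  also have "\<dots> = payoff G u \<sigma> \<tau> (m + Suc n) []"
    by (simp only: Suc.IH add_Suc_right add_Suc)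
  finally show ?case .
qed

lemma integral_utility_upto:
  "(\<integral>p. utility_upto u L p \<partial>play_measure G \<sigma> \<tau>) = payoff G u \<sigma> \<tau> L []"
  using integral_history_pmf_payoff[where u = u and m = 0 and n = L] by (simp add: integral_utility_upto_eq_history_pmf)

text \<open>The choices are independent, so the order of integration is free. Averaging over player
  1 inside leaves, for each fixed \<open>b\<close>, the very integral that occurs in
  \<open>stage_value\<close>.\<close>

lemma payoff_Suc:
  assumes "h \<in> histories G"
  shows "payoff G u \<sigma> \<tau> (Suc n) h = u (last_state G h) +
    (\<integral>b. (\<integral>a. payoff G u \<sigma> \<tau> n (h @ [(last_state G h, a, b)]) \<partial>\<sigma> h) \<partial>\<tau> h)"
proof -
  let ?f = "\<lambda>a b. payoff G u \<sigma> \<tau> n (h @ [(last_state G h, a, b)])"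
  have fin: "finite (set_pmf (\<sigma> h))" "finite (set_pmf (\<tau> h))"
    using set_strategies[OF assms] last_state_in_states[OF G assms] finite_avail1[OF G] finite_avail2[OF G]
    by (meson finite_subset)+
  have "(\<integral>x. ?f (fst x) (snd x) \<partial>pair_pmf (\<sigma> h) (\<tau> h)) = (\<integral>b. (\<integral>a. ?f a b \<partial>\<sigma> h) \<partial>\<tau> h)"
    using fin
    by (subst (1) integral_measure_pmf[of "set_pmf (\<sigma> h) \<times> set_pmf (\<tau> h)"],
        simp, simp, subst (1) integral_measure_pmf[of "set_pmf (\<tau> h)"], simp, simp,
        subst (1) integral_measure_pmf[of "set_pmf (\<sigma> h)"])
      (auto simp: sum.cartesian_product' pmf_pair sum_distrib_left mult_ac intro: sum.swap)
  then show ?thesis using assms by (simp add: next_step_def case_prod_beta')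
qed

end

section \<open>Backward induction\<close>

text \<open>The maximin value of a matrix game. Pure replies suffice because, for a fixed mixed
  action of player 1, an average over replies is at least the smallest entry.\<close>

definition stage_value :: "'a set \<Rightarrow> 'b set \<Rightarrow> ('a \<Rightarrow> 'b \<Rightarrow> real) \<Rightarrow> real" where
  "stage_value A B f = (SUP x\<in>{x. set_pmf x \<subseteq> A}. INF b\<in>B. \<integral>a. f a b \<partial>measure_pmf x)"

lemma pmf_integral_bounds:
  fixes f :: "'a \<Rightarrow> real"
  assumes "finite (set_pmf x)"
  shows "(\<And>a. a \<in> set_pmf x \<Longrightarrow> f a \<le> c) \<Longrightarrow> (\<integral>a. f a \<partial>x) \<le> c"
    and "(\<And>a. a \<in> set_pmf x \<Longrightarrow> c \<le> f a) \<Longrightarrow> c \<le> (\<integral>a. f a \<partial>x)"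
proof -
  have i: "integrable x f" using assms by (rule integrable_measure_pmf_finite)
  show "(\<integral>a. f a \<partial>x) \<le> c" if "\<And>a. a \<in> set_pmf x \<Longrightarrow> f a \<le> c"
    using measure_pmf.integral_le_const[OF i] that by (simp add: AE_measure_pmf_iff)
  show "c \<le> (\<integral>a. f a \<partial>x)" if "\<And>a. a \<in> set_pmf x \<Longrightarrow> c \<le> f a"
    using measure_pmf.integral_ge_const[OF i] that by (simp add: AE_measure_pmf_iff)
qed

lemma pmf_integral_mono:
  fixes f g :: "'a \<Rightarrow> real"
  assumes "finite (set_pmf x)" "\<And>a. a \<in> set_pmf x \<Longrightarrow> f a \<le> g a"
  shows "(\<integral>a. f a \<partial>x) \<le> (\<integral>a. g a \<partial>x)"
  using assms by (intro integral_mono_AE) (auto simp: AE_measure_pmf_iff integrable_measure_pmf_finite)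

context
  fixes A :: "'a set" and B :: "'b set"
  assumes A: "finite A" "A \<noteq> {}" and B: "finite B" "B \<noteq> {}"
begin

lemma stage_bdd_above: "bdd_above ((\<lambda>x. INF b\<in>B. \<integral>a. f a b \<partial>measure_pmf x) ` {x. set_pmf x \<subseteq> A})"
  for f :: "'a \<Rightarrow> 'b \<Rightarrow> real"
proof -
  obtain b where b: "b \<in> B" using B by auto
  have "(INF b\<in>B. \<integral>a. f a b \<partial>measure_pmf x) \<le> Max ((\<lambda>a. f a b) ` A)" if "set_pmf x \<subseteq> A" for x
  proof (rule cINF_lower2[OF _ b])
    show "bdd_below ((\<lambda>b. \<integral>a. f a b \<partial>measure_pmf x) ` B)" using B by simp
    show "(\<integral>a. f a b \<partial>measure_pmf x) \<le> Max ((\<lambda>a. f a b) ` A)"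
      using that A finite_subset by (intro pmf_integral_bounds(1)) (auto intro!: Max_ge)
  qed
  then show ?thesis by (intro bdd_aboveI2) auto
qed

text \<open>Over a finite \<open>B\<close> the infimum is attained; the minimizer becomes player 2's
  pure reply at a single history.\<close>

lemma le_stage_value:
  fixes f :: "'a \<Rightarrow> 'b \<Rightarrow> real"
  assumes "set_pmf x \<subseteq> A"
  shows "\<exists>b\<in>B. (\<integral>a. f a b \<partial>measure_pmf x) \<le> stage_value A B f"
proof -
  let ?g = "\<lambda>b. \<integral>a. f a b \<partial>measure_pmf x"
  have "(INF b\<in>B. ?g b) \<in> ?g ` B"
    using B by (simp add: cInf_eq_Min)
  then obtain b where "b \<in> B" "?g b = (INF b\<in>B. ?g b)" by auto
  moreover have "(INF b\<in>B. ?g b) \<le> stage_value A B f"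
    unfolding stage_value_def using assms by (intro cSUP_upper stage_bdd_above) simp
  ultimately have "?g b \<le> stage_value A B f" by (simp only:)
  then show ?thesis using \<open>b \<in> B\<close> by blast
qed

text \<open>A gap \<open>e\<close> below the supremum avoids a compactness argument on the simplex
  of mixed actions.\<close>

lemma stage_value_approx:
  fixes f :: "'a \<Rightarrow> 'b \<Rightarrow> real"
  assumes "e > 0"
  shows "\<exists>x. set_pmf x \<subseteq> A \<and> (\<forall>b\<in>B. stage_value A B f - e \<le> (\<integral>a. f a b \<partial>measure_pmf x))"
proof -
  obtain a where "a \<in> A" using A by auto
  then have "return_pmf a \<in> {x. set_pmf x \<subseteq> A}" by simp
  then have ne: "{x. set_pmf x \<subseteq> A} \<noteq> {}" by blast
  have "\<exists>x\<in>{x. set_pmf x \<subseteq> A}. stage_value A B f - e < (INF b\<in>B. \<integral>a. f a b \<partial>measure_pmf x)"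
    using assms less_cSUP_iff[OF ne stage_bdd_above, of "stage_value A B f - e" f]
    by (simp add: stage_value_def)
  then obtain x where x: "set_pmf x \<subseteq> A" "stage_value A B f - e < (INF b\<in>B. \<integral>a. f a b \<partial>measure_pmf x)"
    by auto
  moreover have "(INF b\<in>B. \<integral>a. f a b \<partial>measure_pmf x) \<le> (\<integral>a. f a b \<partial>measure_pmf x)" if "b \<in> B" for b
    using that B by (intro cINF_lower) auto
  ultimately show ?thesis by (intro exI[of _ x]) (force intro: less_imp_le order_trans)
qed

text \<open>A mixed action that is near-optimal for \<open>f\<close> is tested in \<open>g\<close>
  against the reply that is best in \<open>g\<close>; at that reply the two expectations compare
  entrywise.\<close>

lemma stage_value_mono:
  fixes f g :: "'a \<Rightarrow> 'b \<Rightarrow> real"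
  assumes "\<And>a b. a \<in> A \<Longrightarrow> b \<in> B \<Longrightarrow> f a b \<le> g a b"
  shows "stage_value A B f \<le> stage_value A B g"
proof (rule field_le_epsilon)
  fix e :: real assume "e > 0"
  from stage_value_approx[OF this, of f] obtain x where x: "set_pmf x \<subseteq> A"
    "\<And>b. b \<in> B \<Longrightarrow> stage_value A B f - e \<le> (\<integral>a. f a b \<partial>measure_pmf x)" by blast
  from le_stage_value[OF x(1), of g] obtain b where b: "b \<in> B"
    "(\<integral>a. g a b \<partial>measure_pmf x) \<le> stage_value A B g" by blast
  have "(\<integral>a. f a b \<partial>measure_pmf x) \<le> (\<integral>a. g a b \<partial>measure_pmf x)"
    using x(1) b(1) A finite_subset assms by (intro pmf_integral_mono) auto
  then show "stage_value A B f \<le> stage_value A B g + e"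
    using x(2)[OF b(1)] b(2) by linarith
qed

end

lemma stage_value_singleton_left: "stage_value {a} B f = (INF b\<in>B. f a b)"
proof -
  have "{x. set_pmf x \<subseteq> {a}} = {return_pmf a}"
    by (auto simp: set_pmf_subset_singleton)
  then show ?thesis by (simp add: stage_value_def)
qed

text \<open>With a single reply player 1 faces a plain maximization: an average never exceeds the
  largest entry, and point masses realize every entry.\<close>

lemma stage_value_singleton_right:
  assumes A: "finite A" "A \<noteq> {}"
  shows "stage_value A {b} f = (SUP a\<in>A. f a b)"
proof (rule antisym)
  show "stage_value A {b} f \<le> (SUP a\<in>A. f a b)"
  proof (rule field_le_epsilon)
    fix e :: real assume "e > 0"
    from stage_value_approx[OF A _ _ this, of "{b}" f] obtain x where x: "set_pmf x \<subseteq> A"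
      "stage_value A {b} f - e \<le> (\<integral>a. f a b \<partial>measure_pmf x)" by auto
    have "(\<integral>a. f a b \<partial>measure_pmf x) \<le> (SUP a\<in>A. f a b)"
      using x(1) A finite_subset by (intro pmf_integral_bounds(1)) (auto intro!: cSUP_upper)
    then show "stage_value A {b} f \<le> (SUP a\<in>A. f a b) + e" using x(2) by linarith
  qed
  show "(SUP a\<in>A. f a b) \<le> stage_value A {b} f"
  proof (rule cSUP_least[OF A(2)])
    fix a assume "a \<in> A"
    then show "f a b \<le> stage_value A {b} f"
      using le_stage_value[OF A, of "{b}" "return_pmf a" f] by simp
  qed
qed

primrec horizon_value :: "('s, 'a) game \<Rightarrow> ('s \<Rightarrow> real) \<Rightarrow> nat \<Rightarrow> 's \<Rightarrow> real" where
  "horizon_value G u 0 s = 0"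
| "horizon_value G u (Suc n) s =
     u s + stage_value (avail1 G s) (avail2 G s) (\<lambda>a b. horizon_value G u n (trans G s a b))"

context
  fixes G :: "('s, 'a) game" and u :: "'s \<Rightarrow> real"
  assumes G: "concurrent_game G"
begin

lemma strategies2_nonempty: "strategies2 G \<noteq> {}"
proof -
  have "(\<lambda>h. return_pmf (SOME b. b \<in> avail2 G (last_state G h))) \<in> strategies2 G"
    using avail2_nonempty[OF G last_state_in_states[OF G]] by (auto simp: strategies2_def some_in_eq)
  then show ?thesis by blast
qed

text \<open>The bound is uniform in \<tau>, which makes the real-valued inner infimum of the game
  value meaningful.\<close>

lemma payoff_lower_bound:
  assumes "\<sigma> \<in> strategies1 G" "\<tau> \<in> strategies2 G" "\<And>s. s \<in> states G \<Longrightarrow> c \<le> u s" "h \<in> histories G"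
  shows "real n * c \<le> payoff G u \<sigma> \<tau> n h"
  using assms(4)
proof (induction n arbitrary: h)
  case 0
  then show ?case by simp
next
  case (Suc n)
  have "real n * c \<le> (\<integral>x. payoff G u \<sigma> \<tau> n (h @ [x]) \<partial>next_step G \<sigma> \<tau> h)"
    using finite_set_next_step[OF G assms(1,2) Suc.prems] Suc.IH
      snoc_next_step_in_histories[OF G assms(1,2) Suc.prems]
    by (intro pmf_integral_bounds(2)) auto
  then show ?case
    using assms(3)[OF last_state_in_states[OF G Suc.prems]] by (simp add: algebra_simps)
qed

text \<open>Player 2 knows \<sigma>, hence the mixed action used at each history, and answers it by
  a minimizer for the remaining horizon.\<close>

lemma exists_reply:
  assumes "\<sigma> \<in> strategies1 G"
  shows "\<exists>\<tau>\<in>strategies2 G. payoff G u \<sigma> \<tau> L [] \<le> horizon_value G u L (start G)"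
proof -
  \<comment> \<open>The equation makes \<open>n\<close> the number of stages left after the current
    one. It has no solution once \<open>length h\<close> reaches \<open>L\<close>, where any
    available action will do.\<close>
  let ?good = "\<lambda>h b. b \<in> avail2 G (last_state G h) \<and> (\<forall>n. L = length h + Suc n \<longrightarrow>
    (\<integral>a. horizon_value G u n (trans G (last_state G h) a b) \<partial>\<sigma> h) \<le>
    stage_value (avail1 G (last_state G h)) (avail2 G (last_state G h))
      (\<lambda>a b. horizon_value G u n (trans G (last_state G h) a b)))"
  have "\<forall>h\<in>histories G. \<exists>b. ?good h b"
  proof
    fix h assume h: "h \<in> histories G"
    have s: "last_state G h \<in> states G" by (rule last_state_in_states[OF G h])
    have "set_pmf (\<sigma> h) \<subseteq> avail1 G (last_state G h)"
      using assms h by (auto simp: strategies1_def)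
    from le_stage_value[OF finite_avail1[OF G s] avail1_nonempty[OF G s]
        finite_avail2[OF G s] avail2_nonempty[OF G s] this,
        of "\<lambda>a b. horizon_value G u (L - Suc (length h)) (trans G (last_state G h) a b)"]
    show "\<exists>b. ?good h b" by auto
  qed
  from bchoice[OF this] obtain r where r: "\<forall>h\<in>histories G. ?good h (r h)" ..
  define \<tau> where "\<tau> h = return_pmf (r h)" for h
  have \<tau>: "\<tau> \<in> strategies2 G" using r by (auto simp: strategies2_def \<tau>_def)
  have "payoff G u \<sigma> \<tau> n h \<le> horizon_value G u n (last_state G h)"
    if "h \<in> histories G" "L = length h + n" for n h
    using that
  proof (induction n arbitrary: h)
    case 0
    then show ?case by simp
  next
    case (Suc n)
    let ?s = "last_state G h"
    have \<sigma>h: "set_pmf (\<sigma> h) \<subseteq> avail1 G ?s" "finite (set_pmf (\<sigma> h))"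
      using assms Suc.prems(1) finite_avail1[OF G last_state_in_states[OF G Suc.prems(1)]]
      by (auto simp: strategies1_def intro: finite_subset)
    have "(\<integral>a. payoff G u \<sigma> \<tau> n (h @ [(?s, a, r h)]) \<partial>\<sigma> h) \<le>
        (\<integral>a. horizon_value G u n (trans G ?s a (r h)) \<partial>\<sigma> h)"
    proof (rule pmf_integral_mono[OF \<sigma>h(2)])
      fix a assume "a \<in> set_pmf (\<sigma> h)"
      then have "h @ [(?s, a, r h)] \<in> histories G"
        using history_snoc[OF G Suc.prems(1)] bspec[OF r Suc.prems(1)] \<sigma>h by auto
      from Suc.IH[OF this] Suc.prems(2)
      show "payoff G u \<sigma> \<tau> n (h @ [(?s, a, r h)]) \<le> horizon_value G u n (trans G ?s a (r h))"
        by simp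
    qed
    moreover have "\<dots> \<le> stage_value (avail1 G ?s) (avail2 G ?s)
        (\<lambda>a b. horizon_value G u n (trans G ?s a b))"
      using bspec[OF r Suc.prems(1)] Suc.prems(2) by blast
    ultimately show ?case
      unfolding payoff_Suc[OF G assms \<tau> Suc.prems(1)] by (simp add: \<tau>_def)
  qed
  from this[OF Nil_in_histories[OF G], of L] show ?thesis using \<tau> by auto
qed

text \<open>Each stage is played within \<open>e\<close> of its maximin, whatever player 2 does, and
  the losses add up over the \<open>L\<close> stages.\<close>

lemma exists_near_optimal_strategy:
  assumes "e > 0"
  shows "\<exists>\<sigma>\<in>strategies1 G. \<forall>\<tau>\<in>strategies2 G.
    horizon_value G u L (start G) - real L * e \<le> payoff G u \<sigma> \<tau> L []"
proof -
  let ?good = "\<lambda>h x. set_pmf x \<subseteq> avail1 G (last_state G h) \<and>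
    (\<forall>n. L = length h + Suc n \<longrightarrow> (\<forall>b\<in>avail2 G (last_state G h).
      stage_value (avail1 G (last_state G h)) (avail2 G (last_state G h))
        (\<lambda>a b. horizon_value G u n (trans G (last_state G h) a b)) - e \<le>
      (\<integral>a. horizon_value G u n (trans G (last_state G h) a b) \<partial>measure_pmf x)))"
  have "\<forall>h\<in>histories G. \<exists>x. ?good h x"
  proof
    fix h assume h: "h \<in> histories G"
    have s: "last_state G h \<in> states G" by (rule last_state_in_states[OF G h])
    from stage_value_approx[OF finite_avail1[OF G s] avail1_nonempty[OF G s]
        finite_avail2[OF G s] avail2_nonempty[OF G s] assms,
        of "\<lambda>a b. horizon_value G u (L - Suc (length h)) (trans G (last_state G h) a b)"]
    show "\<exists>x. ?good h x" by auto
  qed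
  from bchoice[OF this] obtain \<sigma> where r: "\<forall>h\<in>histories G. ?good h (\<sigma> h)" ..
  have \<sigma>: "\<sigma> \<in> strategies1 G" using r by (auto simp: strategies1_def)
  have "horizon_value G u n (last_state G h) - real n * e \<le> payoff G u \<sigma> \<tau> n h"
    if \<tau>: "\<tau> \<in> strategies2 G" and "h \<in> histories G" "L = length h + n" for n h \<tau>
    using that(2,3)
  proof (induction n arbitrary: h)
    case 0
    then show ?case by simp
  next
    case (Suc n)
    let ?s = "last_state G h"
    have fin: "finite (avail1 G ?s)" "finite (avail2 G ?s)"
      using finite_avail1[OF G] finite_avail2[OF G] last_state_in_states[OF G Suc.prems(1)] by auto
    have sub: "set_pmf (\<sigma> h) \<subseteq> avail1 G ?s" "set_pmf (\<tau> h) \<subseteq> avail2 G ?s"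
      by (rule set_strategies[OF G \<sigma> \<tau> Suc.prems(1)])+
    then have fin': "finite (set_pmf (\<sigma> h))" "finite (set_pmf (\<tau> h))"
      using fin finite_subset by blast+
    let ?v = "stage_value (avail1 G ?s) (avail2 G ?s) (\<lambda>a b. horizon_value G u n (trans G ?s a b))"
    have "?v - e - real n * e \<le>
        (\<integral>b. (\<integral>a. payoff G u \<sigma> \<tau> n (h @ [(?s, a, b)]) \<partial>\<sigma> h) \<partial>\<tau> h)"
    proof (rule pmf_integral_bounds(2)[OF fin'(2)])
      fix b assume b: "b \<in> set_pmf (\<tau> h)"
      have "?v - e \<le> (\<integral>a. horizon_value G u n (trans G ?s a b) \<partial>\<sigma> h)"
        using bspec[OF r Suc.prems(1)] Suc.prems(2) b sub by blast
      \<comment> \<open>The accumulated loss of the later stages is a constant, so it passes through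
        the integral unchanged.\<close>
      also have "\<dots> \<le> (\<integral>a. payoff G u \<sigma> \<tau> n (h @ [(?s, a, b)]) + real n * e \<partial>\<sigma> h)"
      proof (rule pmf_integral_mono[OF fin'(1)])
        fix a assume "a \<in> set_pmf (\<sigma> h)"
        then have "h @ [(?s, a, b)] \<in> histories G"
          using history_snoc[OF G Suc.prems(1)] b sub by auto
        from Suc.IH[OF this] Suc.prems(2)
        show "horizon_value G u n (trans G ?s a b) \<le> payoff G u \<sigma> \<tau> n (h @ [(?s, a, b)]) + real n * e"
          by simp
      qed
      also have "\<dots> = (\<integral>a. payoff G u \<sigma> \<tau> n (h @ [(?s, a, b)]) \<partial>\<sigma> h) + real n * e"
        using fin' by (subst Bochner_Integration.integral_add) (auto intro: integrable_measure_pmf_finite)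
      finally show "?v - e - real n * e \<le> (\<integral>a. payoff G u \<sigma> \<tau> n (h @ [(?s, a, b)]) \<partial>\<sigma> h)"
        by simp
    qed
    then show ?case
      unfolding payoff_Suc[OF G \<sigma> \<tau> Suc.prems(1)] by (simp add: algebra_simps)
  qed
  from this[OF _ Nil_in_histories[OF G], of _ L] show ?thesis using \<sigma> by auto
qed

lemma game_value_eq_horizon_value: "game_value L G u = horizon_value G u L (start G)"
proof -
  let ?E = "\<lambda>\<sigma> \<tau>. payoff G u \<sigma> \<tau> L []" and ?V = "horizon_value G u L (start G)"
  have bdd: "bdd_below (?E \<sigma> ` strategies2 G)" if "\<sigma> \<in> strategies1 G" for \<sigma>
  proof (rule bdd_belowI2)
    fix \<tau> assume "\<tau> \<in> strategies2 G"
    then show "real L * Min (u ` states G) \<le> ?E \<sigma> \<tau>"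
      using G that Nil_in_histories[OF G]
      by (intro payoff_lower_bound) (auto simp: concurrent_game_def)
  qed
  have upper: "(INF \<tau>\<in>strategies2 G. ?E \<sigma> \<tau>) \<le> ?V" if "\<sigma> \<in> strategies1 G" for \<sigma>
    using exists_reply[OF that, of L] bdd[OF that] by (auto intro: cINF_lower2)
  have value_eq: "game_value L G u = (SUP \<sigma>\<in>strategies1 G. INF \<tau>\<in>strategies2 G. ?E \<sigma> \<tau>)"
    unfolding game_value_def by (simp add: integral_utility_upto[OF G] cong: SUP_cong INF_cong)
  have ne: "strategies1 G \<noteq> {}"
    using exists_near_optimal_strategy[of 1 L] by auto
  show ?thesis
  proof (rule antisym)
    show "game_value L G u \<le> ?V"
      unfolding value_eq using ne upper by (rule cSUP_least)
    show "?V \<le> game_value L G u"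
    proof (rule field_le_epsilon)
      fix e :: real assume "e > 0"
      \<comment> \<open>With this loss per stage the total over \<open>L\<close> stages stays below
        \<open>e\<close>; the added 1 covers \<open>L = 0\<close>.\<close>
      then have "e / (real L + 1) > 0" by simp
      from exists_near_optimal_strategy[OF this, of L] obtain \<sigma> where \<sigma>: "\<sigma> \<in> strategies1 G"
        and le: "\<And>\<tau>. \<tau> \<in> strategies2 G \<Longrightarrow> ?V - real L * (e / (real L + 1)) \<le> ?E \<sigma> \<tau>" by blast
      have "?V - real L * (e / (real L + 1)) \<le> (INF \<tau>\<in>strategies2 G. ?E \<sigma> \<tau>)"
        using strategies2_nonempty le by (rule cINF_greatest)
      also have "\<dots> \<le> game_value L G u"
        unfolding value_eq using upper by (intro cSUP_upper[OF \<sigma>] bdd_aboveI2) auto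
      finally have "?V - real L * (e / (real L + 1)) \<le> game_value L G u" .
      moreover have "e * (real L / (real L + 1)) \<le> e * 1"
        using \<open>e > 0\<close> by (intro mult_left_mono) simp_all
      ultimately show "?V \<le> game_value L G u + e" by (simp add: mult.commute)
    qed
  qed
qed

end

section \<open>Abstractions\<close>

locale abstractable_game =
  fixes G :: "('s, 'a) game" and P :: "'s set set"
  assumes concurrent: "concurrent_game G"
    and partition: "partition_on (states G) P"
    and exist: "abstractions_exist G P"
begin

lemma finite_states: "finite (states G)"
  using concurrent by (simp add: concurrent_game_def)

lemma Union_blocks: "\<Union>P = states G"
  using partition by (simp add: partition_on_def)

lemma finite_blocks: "finite P"
  by (rule finite_elements[OF finite_states partition])

lemma block_nonempty: "\<pi> \<in> P \<Longrightarrow> \<pi> \<noteq> {}"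
  using partition by (auto simp: partition_on_def)

lemma finite_block: "\<pi> \<in> P \<Longrightarrow> finite \<pi>"
  using Union_blocks by (intro finite_subset[OF _ finite_states]) auto

lemma block_unique: "\<pi> \<in> P \<Longrightarrow> \<pi>' \<in> P \<Longrightarrow> s \<in> \<pi> \<Longrightarrow> s \<in> \<pi>' \<Longrightarrow> \<pi> = \<pi>'"
  using partition by (auto dest: partition_onD2 disjointD)

text \<open>Existence of the abstraction makes the representative picked by \<open>SOME\<close>
  irrelevant.\<close>

lemma block_avail_eq:
  assumes "\<pi> \<in> P" "s \<in> \<pi>"
  shows "block_avail (avail1 G) \<pi> = Act ` avail1 G s" "block_avail (avail2 G) \<pi> = Act ` avail2 G s"
proof -
  have "(SOME s. s \<in> \<pi>) \<in> \<pi>" using assms(2) by (rule someI)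
  then have "avail1 G (SOME s. s \<in> \<pi>) = avail1 G s \<and> avail2 G (SOME s. s \<in> \<pi>) = avail2 G s"
    using exist assms unfolding abstractions_exist_def by blast
  then show "block_avail (avail1 G) \<pi> = Act ` avail1 G s" "block_avail (avail2 G) \<pi> = Act ` avail2 G s"
    by (simp_all add: block_avail_def)
qed

lemma block_avail_props:
  assumes "\<pi> \<in> P"
  shows "finite (block_avail (avail1 G) \<pi>)" "block_avail (avail1 G) \<pi> \<noteq> {}"
    "block_avail (avail1 G) \<pi> \<subseteq> Act ` acts G"
    "finite (block_avail (avail2 G) \<pi>)" "block_avail (avail2 G) \<pi> \<noteq> {}"
    "block_avail (avail2 G) \<pi> \<subseteq> Act ` acts G"
proof -
  obtain s where s: "s \<in> \<pi>" using block_nonempty[OF assms] by auto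
  then have st: "s \<in> states G" using Union_blocks assms by blast
  then have "avail1 G s \<subseteq> acts G" "avail2 G s \<subseteq> acts G"
    using concurrent by (simp_all add: concurrent_game_def)
  then show "finite (block_avail (avail1 G) \<pi>)" "block_avail (avail1 G) \<pi> \<noteq> {}"
    "block_avail (avail1 G) \<pi> \<subseteq> Act ` acts G"
    "finite (block_avail (avail2 G) \<pi>)" "block_avail (avail2 G) \<pi> \<noteq> {}"
    "block_avail (avail2 G) \<pi> \<subseteq> Act ` acts G"
    using finite_avail1[OF concurrent st] finite_avail2[OF concurrent st]
      avail1_nonempty[OF concurrent st] avail2_nonempty[OF concurrent st]
    unfolding block_avail_eq[OF assms s] by (simp_all add: image_mono)
qed

lemma finite_successors: "finite (successors G P \<pi> a b)"
  using finite_blocks by (simp add: successors_def)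

text \<open>Dummy states carry arbitrary actions of the game, not only those available at the block.
  Closure of \<open>trans\<close> under all of \<open>acts G\<close> therefore gives the active
  player a move in every dummy state.\<close>

lemma successors_nonempty:
  assumes "\<pi> \<in> P" "a \<in> acts G" "b \<in> acts G"
  shows "successors G P \<pi> a b \<noteq> {}"
proof -
  obtain s where s: "s \<in> \<pi>" using block_nonempty[OF assms(1)] by auto
  then have "s \<in> states G" using Union_blocks assms(1) by blast
  then have "trans G s a b \<in> \<Union>P"
    using concurrent assms unfolding Union_blocks concurrent_game_def by blast
  then show ?thesis using s by (auto simp: successors_def)
qed

lemma abs_start_block:
  obtains \<pi> where "abs_start G P = Block \<pi>" "\<pi> \<in> P" "start G \<in> \<pi>"
proof -
  have "start G \<in> states G" using concurrent by (simp add: concurrent_game_def)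
  then obtain \<pi> where \<pi>: "\<pi> \<in> P" "start G \<in> \<pi>"
    unfolding Union_blocks[symmetric] by (rule UnionE)
  have "(THE \<pi>. \<pi> \<in> P \<and> start G \<in> \<pi>) = \<pi>"
  proof (rule the_equality)
    show "\<pi>' = \<pi>" if "\<pi>' \<in> P \<and> start G \<in> \<pi>'" for \<pi>'
      using that by (intro block_unique[of \<pi>' \<pi> "start G"]) (simp_all add: \<pi>)
  qed (simp add: \<pi>)
  then show thesis by (intro that[of \<pi>]) (simp_all add: abs_start_def \<pi>)
qed

lemma abs_states_simps [simp]:
  "Block \<pi> \<in> abs_states G P \<longleftrightarrow> \<pi> \<in> P"
  "Dummy \<pi> a b \<in> abs_states G P \<longleftrightarrow> \<pi> \<in> P \<and> a \<in> acts G \<and> b \<in> acts G"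
  by (auto simp: abs_states_def dummies_def)

lemma abs_acts_simps [simp]:
  "Act a \<in> abs_acts G P \<longleftrightarrow> a \<in> acts G" "Goto \<pi> \<in> abs_acts G P \<longleftrightarrow> \<pi> \<in> P"
  by (auto simp: abs_acts_def)

lemma finite_abs: "finite (abs_states G P)" "finite (abs_acts G P)"
proof -
  have "dummies G P = (\<lambda>(\<pi>, a, b). Dummy \<pi> a b) ` (P \<times> acts G \<times> acts G)"
    by (force simp: dummies_def)
  then show "finite (abs_states G P)" "finite (abs_acts G P)"
    using finite_blocks concurrent by (simp_all add: abs_states_def abs_acts_def concurrent_game_def)
qed

lemma abs_start_in_abs_states: "abs_start G P \<in> abs_states G P"
  by (rule abs_start_block) simp

lemma lower_trans_in_abs_states:
  "x \<in> abs_states G P \<Longrightarrow> a \<in> abs_acts G P \<Longrightarrow> b \<in> abs_acts G P \<Longrightarrow> lower_trans x a b \<in> abs_states G P"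
  by (cases x; cases a; cases b) auto

lemma upper_trans_in_abs_states:
  "x \<in> abs_states G P \<Longrightarrow> a \<in> abs_acts G P \<Longrightarrow> b \<in> abs_acts G P \<Longrightarrow> upper_trans x a b \<in> abs_states G P"
  by (cases x; cases a; cases b) auto

text \<open>Stated for both action maps at once because the lower and the upper abstraction swap
  which player is passive.\<close>

lemma abs_avail_props:
  assumes "dummy_choice G P c" "x \<in> abs_states G P"
    and "\<Gamma> = avail1 G \<or> \<Gamma> = avail2 G"
  shows "passive_avail \<Gamma> c x \<subseteq> abs_acts G P \<and> passive_avail \<Gamma> c x \<noteq> {} \<and>
    active_avail G P \<Gamma> x \<subseteq> abs_acts G P \<and> active_avail G P \<Gamma> x \<noteq> {}"
proof (cases x)
  case (Block \<pi>)
  then have "\<pi> \<in> P" using assms(2) by simp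
  then have "block_avail \<Gamma> \<pi> \<subseteq> Act ` acts G" "block_avail \<Gamma> \<pi> \<noteq> {}"
    using block_avail_props assms(3) by blast+
  then show ?thesis using Block by (auto simp: abs_acts_def)
next
  case (Dummy \<pi> a b)
  then have "\<pi> \<in> P" "a \<in> acts G" "b \<in> acts G" using assms(2) by auto
  then show ?thesis using Dummy assms(1) successors_nonempty[of \<pi> a b]
    by (auto simp: dummy_choice_def dummies_def abs_acts_def successors_def)
qed

lemma concurrent_game_lower:
  assumes "dummy_choice G P c"
  shows "concurrent_game (lower_abstraction G P c)"
  using finite_abs abs_start_in_abs_states lower_trans_in_abs_states
    abs_avail_props[OF assms, of _ "avail1 G"] abs_avail_props[OF assms, of _ "avail2 G"]
  unfolding concurrent_game_def by (simp add: lower_abstraction_def)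

lemma concurrent_game_upper:
  assumes "dummy_choice G P c"
  shows "concurrent_game (upper_abstraction G P c)"
  using finite_abs abs_start_in_abs_states upper_trans_in_abs_states
    abs_avail_props[OF assms, of _ "avail1 G"] abs_avail_props[OF assms, of _ "avail2 G"]
  unfolding concurrent_game_def by (simp add: upper_abstraction_def)

end

text \<open>The forced action drops out, since \<open>lower_trans\<close> ignores player 1 at a
  dummy state; so abstractions with unrelated choices \<open>c\<close> can be compared.\<close>

lemma horizon_value_lower_Dummy:
  "horizon_value (lower_abstraction G P c) (lower_utility u) (Suc n) (Dummy \<pi> a b) =
     (INF \<pi>'\<in>successors G P \<pi> a b.
       horizon_value (lower_abstraction G P c) (lower_utility u) n (Block \<pi>'))"
  by (simp add: lower_abstraction_def stage_value_singleton_left image_image)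

lemma horizon_value_upper_Dummy:
  assumes "finite (successors G P \<pi> a b)" "successors G P \<pi> a b \<noteq> {}"
  shows "horizon_value (upper_abstraction G P c) (upper_utility u) (Suc n) (Dummy \<pi> a b) =
     (SUP \<pi>'\<in>successors G P \<pi> a b.
       horizon_value (upper_abstraction G P c) (upper_utility u) n (Block \<pi>'))"
  using assms by (simp add: upper_abstraction_def stage_value_singleton_right image_image)

lemma horizon_value_lower_Block:
  "horizon_value (lower_abstraction G P c) (lower_utility u) (Suc n) (Block \<pi>) =
     Min (u ` \<pi>) + stage_value (block_avail (avail1 G) \<pi>) (block_avail (avail2 G) \<pi>)
       (\<lambda>a b. horizon_value (lower_abstraction G P c) (lower_utility u) n (lower_trans (Block \<pi>) a b))"
  by (simp add: lower_abstraction_def)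

lemma horizon_value_upper_Block:
  "horizon_value (upper_abstraction G P c) (upper_utility u) (Suc n) (Block \<pi>) =
     Max (u ` \<pi>) + stage_value (block_avail (avail1 G) \<pi>) (block_avail (avail2 G) \<pi>)
       (\<lambda>a b. horizon_value (upper_abstraction G P c) (upper_utility u) n (upper_trans (Block \<pi>) a b))"
  by (simp add: upper_abstraction_def)

lemma (in abstractable_game) horizon_value_lower_le_upper:
  assumes "\<pi> \<in> P"
  shows "horizon_value (lower_abstraction G P c) (lower_utility u) (2 * n) (Block \<pi>) \<le>
    horizon_value (upper_abstraction G P d) (upper_utility u) (2 * n) (Block \<pi>)"
  using assms
proof (induction n arbitrary: \<pi>)
  case 0
  then show ?case by simp
next
  case (Suc n)
  let ?l = "horizon_value (lower_abstraction G P c) (lower_utility u)"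
    and ?h = "horizon_value (upper_abstraction G P d) (upper_utility u)"
  note av = block_avail_props[OF Suc.prems]
  have "Min (u ` \<pi>) \<le> Max (u ` \<pi>)"
    using finite_block[OF Suc.prems] block_nonempty[OF Suc.prems] by simp
  moreover have "stage_value (block_avail (avail1 G) \<pi>) (block_avail (avail2 G) \<pi>)
       (\<lambda>x y. ?l (Suc (2 * n)) (lower_trans (Block \<pi>) x y)) \<le>
     stage_value (block_avail (avail1 G) \<pi>) (block_avail (avail2 G) \<pi>)
       (\<lambda>x y. ?h (Suc (2 * n)) (upper_trans (Block \<pi>) x y))"
  proof (rule stage_value_mono[OF av(1,2,4,5)])
    fix x y assume "x \<in> block_avail (avail1 G) \<pi>" "y \<in> block_avail (avail2 G) \<pi>"
    then obtain a b where x: "x = Act a" "a \<in> acts G" and y: "y = Act b" "b \<in> acts G"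
      using av(3,6) by blast
    note ne = successors_nonempty[OF Suc.prems x(2) y(2)]
    \<comment> \<open>Any one common successor separates the minimum over all successors from the
      maximum over them.\<close>
    then obtain \<pi>' where \<pi>': "\<pi>' \<in> successors G P \<pi> a b" by auto
    then have "(INF \<pi>'\<in>successors G P \<pi> a b. ?l (2 * n) (Block \<pi>')) \<le> ?l (2 * n) (Block \<pi>')"
      using finite_successors by (intro cINF_lower) auto
    also have "\<dots> \<le> ?h (2 * n) (Block \<pi>')"
      using \<pi>' by (intro Suc.IH) (simp add: successors_def)
    also have "\<dots> \<le> (SUP \<pi>'\<in>successors G P \<pi> a b. ?h (2 * n) (Block \<pi>'))"
      using \<pi>' finite_successors by (intro cSUP_upper) auto
    finally show "?l (Suc (2 * n)) (lower_trans (Block \<pi>) x y) \<le> ?h (Suc (2 * n)) (upper_trans (Block \<pi>) x y)"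
      by (simp only: x y lower_trans.simps upper_trans.simps
          horizon_value_lower_Dummy horizon_value_upper_Dummy[OF finite_successors ne])
  qed
  ultimately show ?case
    by (simp only: mult_Suc_right add_2_eq_Suc horizon_value_lower_Block horizon_value_upper_Block
        add_mono)
qed

section \<open>Comparison of a coarse and a fine partition\<close>

locale refined_game =
  coarse: abstractable_game G P\<^sub>1 + fine: abstractable_game G P\<^sub>2
  for G :: "('s, 'a) game" and P\<^sub>1 P\<^sub>2 +
  assumes refinement: "refinement P\<^sub>2 P\<^sub>1"
begin

text \<open>A coarse block that meets a fine block is a union of fine blocks, and by disjointness
  the one covering the common point is the given block.\<close>

lemma exists_coarse_block:
  assumes "\<pi>\<^sub>2 \<in> P\<^sub>2"
  shows "\<exists>\<pi>\<^sub>1\<in>P\<^sub>1. \<pi>\<^sub>2 \<subseteq> \<pi>\<^sub>1"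
proof -
  obtain s where s: "s \<in> \<pi>\<^sub>2" using fine.block_nonempty[OF assms] by auto
  then have "s \<in> \<Union>P\<^sub>1"
    using assms by (metis UnionI coarse.Union_blocks fine.Union_blocks)
  then obtain \<pi>\<^sub>1 where \<pi>\<^sub>1: "\<pi>\<^sub>1 \<in> P\<^sub>1" "s \<in> \<pi>\<^sub>1" by (rule UnionE)
  obtain C where C: "C \<subseteq> P\<^sub>2" "\<pi>\<^sub>1 = \<Union>C"
    using bspec[OF refinement[unfolded refinement_def] \<pi>\<^sub>1(1)] by (elim exE conjE)
  obtain \<pi> where \<pi>: "\<pi> \<in> C" "s \<in> \<pi>" using \<pi>\<^sub>1(2) unfolding C(2) by (rule UnionE)
  have "\<pi>\<^sub>2 = \<pi>" by (rule fine.block_unique[OF assms subsetD[OF C(1) \<pi>(1)] s \<pi>(2)])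
  then have "\<pi>\<^sub>2 \<subseteq> \<pi>\<^sub>1" using \<pi>(1) by (simp add: C(2) Union_upper)
  then show ?thesis by (rule bexI[OF _ \<pi>\<^sub>1(1)])
qed

text \<open>The state that witnesses the fine transition also lies in the coarse block, so it
  witnesses the coarse transition.\<close>

lemma exists_coarse_successor:
  assumes "\<pi>\<^sub>2 \<subseteq> \<pi>\<^sub>1" "\<rho>\<^sub>2 \<in> successors G P\<^sub>2 \<pi>\<^sub>2 a b"
  obtains \<rho>\<^sub>1 where "\<rho>\<^sub>1 \<in> successors G P\<^sub>1 \<pi>\<^sub>1 a b" "\<rho>\<^sub>1 \<in> P\<^sub>1" "\<rho>\<^sub>2 \<in> P\<^sub>2" "\<rho>\<^sub>2 \<subseteq> \<rho>\<^sub>1"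
proof -
  obtain s where s: "\<rho>\<^sub>2 \<in> P\<^sub>2" "s \<in> \<pi>\<^sub>2" "trans G s a b \<in> \<rho>\<^sub>2"
    using assms(2) by (auto simp: successors_def)
  obtain \<rho>\<^sub>1 where \<rho>\<^sub>1: "\<rho>\<^sub>1 \<in> P\<^sub>1" "\<rho>\<^sub>2 \<subseteq> \<rho>\<^sub>1" using exists_coarse_block[OF s(1)] by (rule bexE)
  have "\<rho>\<^sub>1 \<in> successors G P\<^sub>1 \<pi>\<^sub>1 a b"
    using \<rho>\<^sub>1 s assms(1) by (auto simp: successors_def)
  then show thesis using \<rho>\<^sub>1 s(1) by (intro that[of \<rho>\<^sub>1])
qed

lemma block_avail_refine:
  assumes "\<pi>\<^sub>1 \<in> P\<^sub>1" "\<pi>\<^sub>2 \<in> P\<^sub>2" "\<pi>\<^sub>2 \<subseteq> \<pi>\<^sub>1"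
  shows "block_avail (avail1 G) \<pi>\<^sub>2 = block_avail (avail1 G) \<pi>\<^sub>1"
    "block_avail (avail2 G) \<pi>\<^sub>2 = block_avail (avail2 G) \<pi>\<^sub>1"
proof -
  obtain s where s: "s \<in> \<pi>\<^sub>2" using fine.block_nonempty[OF assms(2)] by auto
  then show "block_avail (avail1 G) \<pi>\<^sub>2 = block_avail (avail1 G) \<pi>\<^sub>1"
    "block_avail (avail2 G) \<pi>\<^sub>2 = block_avail (avail2 G) \<pi>\<^sub>1"
    using coarse.block_avail_eq[OF assms(1) subsetD[OF assms(3) s]]
      fine.block_avail_eq[OF assms(2) s] by simp_all
qed

text \<open>Both blocks offer the same matrix of actions, so entrywise comparison suffices. In the
  coarse game player 2 can answer each fine successor by a coarse one containing it, which by
  induction has no larger value.\<close>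

lemma horizon_value_lower_refine:
  assumes "\<pi>\<^sub>1 \<in> P\<^sub>1" "\<pi>\<^sub>2 \<in> P\<^sub>2" "\<pi>\<^sub>2 \<subseteq> \<pi>\<^sub>1"
  shows "horizon_value (lower_abstraction G P\<^sub>1 c\<^sub>1) (lower_utility u) (2 * n) (Block \<pi>\<^sub>1) \<le>
    horizon_value (lower_abstraction G P\<^sub>2 c\<^sub>2) (lower_utility u) (2 * n) (Block \<pi>\<^sub>2)"
  using assms
proof (induction n arbitrary: \<pi>\<^sub>1 \<pi>\<^sub>2)
  case 0
  then show ?case by simp
next
  case (Suc n)
  let ?v = "horizon_value (lower_abstraction G P\<^sub>1 c\<^sub>1) (lower_utility u)"
    and ?w = "horizon_value (lower_abstraction G P\<^sub>2 c\<^sub>2) (lower_utility u)"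
  note av = coarse.block_avail_props[OF Suc.prems(1)]
  have "Min (u ` \<pi>\<^sub>1) \<le> Min (u ` \<pi>\<^sub>2)"
    using coarse.finite_block fine.block_nonempty Suc.prems by (intro Min_antimono) auto
  moreover have "stage_value (block_avail (avail1 G) \<pi>\<^sub>1) (block_avail (avail2 G) \<pi>\<^sub>1)
       (\<lambda>x y. ?v (Suc (2 * n)) (lower_trans (Block \<pi>\<^sub>1) x y)) \<le>
     stage_value (block_avail (avail1 G) \<pi>\<^sub>1) (block_avail (avail2 G) \<pi>\<^sub>1)
       (\<lambda>x y. ?w (Suc (2 * n)) (lower_trans (Block \<pi>\<^sub>2) x y))"
  proof (rule stage_value_mono[OF av(1,2,4,5)])
    fix x y assume "x \<in> block_avail (avail1 G) \<pi>\<^sub>1" "y \<in> block_avail (avail2 G) \<pi>\<^sub>1"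
    then obtain a b where x: "x = Act a" "a \<in> acts G" and y: "y = Act b" "b \<in> acts G"
      using av(3,6) by blast
    have "(INF \<rho>\<in>successors G P\<^sub>1 \<pi>\<^sub>1 a b. ?v (2 * n) (Block \<rho>)) \<le>
        (INF \<rho>\<in>successors G P\<^sub>2 \<pi>\<^sub>2 a b. ?w (2 * n) (Block \<rho>))"
    proof (rule cINF_mono)
      show "successors G P\<^sub>2 \<pi>\<^sub>2 a b \<noteq> {}"
        by (rule fine.successors_nonempty[OF Suc.prems(2) x(2) y(2)])
      show "bdd_below ((\<lambda>\<rho>. ?v (2 * n) (Block \<rho>)) ` successors G P\<^sub>1 \<pi>\<^sub>1 a b)"
        using coarse.finite_successors by simp
      show "\<exists>\<rho>\<in>successors G P\<^sub>1 \<pi>\<^sub>1 a b. ?v (2 * n) (Block \<rho>) \<le> ?w (2 * n) (Block \<rho>')"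
        if "\<rho>' \<in> successors G P\<^sub>2 \<pi>\<^sub>2 a b" for \<rho>'
        by (rule exists_coarse_successor[OF Suc.prems(3) that]) (rule bexI[rotated], assumption, rule Suc.IH)
    qed
    then show "?v (Suc (2 * n)) (lower_trans (Block \<pi>\<^sub>1) x y) \<le> ?w (Suc (2 * n)) (lower_trans (Block \<pi>\<^sub>2) x y)"
      by (simp only: x y lower_trans.simps horizon_value_lower_Dummy)
  qed
  ultimately show ?case
    by (simp only: mult_Suc_right add_2_eq_Suc horizon_value_lower_Block
        block_avail_refine[OF Suc.prems] add_mono)
qed

text \<open>Here player 1 resolves the dummy states: every successor open to player 1 in the fine
  game lies in a coarse successor, which by induction has at least its value.\<close>

lemma horizon_value_upper_refine:
  assumes "\<pi>\<^sub>1 \<in> P\<^sub>1" "\<pi>\<^sub>2 \<in> P\<^sub>2" "\<pi>\<^sub>2 \<subseteq> \<pi>\<^sub>1"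
  shows "horizon_value (upper_abstraction G P\<^sub>2 d\<^sub>2) (upper_utility u) (2 * n) (Block \<pi>\<^sub>2) \<le>
    horizon_value (upper_abstraction G P\<^sub>1 d\<^sub>1) (upper_utility u) (2 * n) (Block \<pi>\<^sub>1)"
  using assms
proof (induction n arbitrary: \<pi>\<^sub>1 \<pi>\<^sub>2)
  case 0
  then show ?case by simp
next
  case (Suc n)
  let ?v = "horizon_value (upper_abstraction G P\<^sub>1 d\<^sub>1) (upper_utility u)"
    and ?w = "horizon_value (upper_abstraction G P\<^sub>2 d\<^sub>2) (upper_utility u)"
  note av = coarse.block_avail_props[OF Suc.prems(1)]
  have "Max (u ` \<pi>\<^sub>2) \<le> Max (u ` \<pi>\<^sub>1)"
    using coarse.finite_block fine.block_nonempty Suc.prems by (intro Max_mono) auto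
  moreover have "stage_value (block_avail (avail1 G) \<pi>\<^sub>1) (block_avail (avail2 G) \<pi>\<^sub>1)
       (\<lambda>x y. ?w (Suc (2 * n)) (upper_trans (Block \<pi>\<^sub>2) x y)) \<le>
     stage_value (block_avail (avail1 G) \<pi>\<^sub>1) (block_avail (avail2 G) \<pi>\<^sub>1)
       (\<lambda>x y. ?v (Suc (2 * n)) (upper_trans (Block \<pi>\<^sub>1) x y))"
  proof (rule stage_value_mono[OF av(1,2,4,5)])
    fix x y assume "x \<in> block_avail (avail1 G) \<pi>\<^sub>1" "y \<in> block_avail (avail2 G) \<pi>\<^sub>1"
    then obtain a b where x: "x = Act a" "a \<in> acts G" and y: "y = Act b" "b \<in> acts G"
      using av(3,6) by blast
    note ne = fine.successors_nonempty[OF Suc.prems(2) x(2) y(2)]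
      coarse.successors_nonempty[OF Suc.prems(1) x(2) y(2)]
    have "(SUP \<rho>\<in>successors G P\<^sub>2 \<pi>\<^sub>2 a b. ?w (2 * n) (Block \<rho>)) \<le>
        (SUP \<rho>\<in>successors G P\<^sub>1 \<pi>\<^sub>1 a b. ?v (2 * n) (Block \<rho>))"
    proof (rule cSUP_mono[OF ne(1)])
      show "bdd_above ((\<lambda>\<rho>. ?v (2 * n) (Block \<rho>)) ` successors G P\<^sub>1 \<pi>\<^sub>1 a b)"
        using coarse.finite_successors by simp
      show "\<exists>\<rho>\<in>successors G P\<^sub>1 \<pi>\<^sub>1 a b. ?w (2 * n) (Block \<rho>') \<le> ?v (2 * n) (Block \<rho>)"
        if "\<rho>' \<in> successors G P\<^sub>2 \<pi>\<^sub>2 a b" for \<rho>'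
        by (rule exists_coarse_successor[OF Suc.prems(3) that]) (rule bexI[rotated], assumption, rule Suc.IH)
    qed
    then show "?w (Suc (2 * n)) (upper_trans (Block \<pi>\<^sub>2) x y) \<le> ?v (Suc (2 * n)) (upper_trans (Block \<pi>\<^sub>1) x y)"
      by (simp only: x y upper_trans.simps
          horizon_value_upper_Dummy[OF fine.finite_successors ne(1)]
          horizon_value_upper_Dummy[OF coarse.finite_successors ne(2)])
  qed
  ultimately show ?case
    by (simp only: mult_Suc_right add_2_eq_Suc horizon_value_upper_Block
        block_avail_refine[OF Suc.prems] add_mono)
qed

text \<open>A coarse block containing the fine start block contains \<open>start G\<close>, and only
  one coarse block does.\<close>

lemma start_blocks:
  obtains \<pi>\<^sub>1 \<pi>\<^sub>2 where "abs_start G P\<^sub>1 = Block \<pi>\<^sub>1" "abs_start G P\<^sub>2 = Block \<pi>\<^sub>2"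
    "\<pi>\<^sub>1 \<in> P\<^sub>1" "\<pi>\<^sub>2 \<in> P\<^sub>2" "\<pi>\<^sub>2 \<subseteq> \<pi>\<^sub>1"
proof -
  obtain \<pi>\<^sub>1 where 1: "abs_start G P\<^sub>1 = Block \<pi>\<^sub>1" "\<pi>\<^sub>1 \<in> P\<^sub>1" "start G \<in> \<pi>\<^sub>1"
    by (rule coarse.abs_start_block)
  obtain \<pi>\<^sub>2 where 2: "abs_start G P\<^sub>2 = Block \<pi>\<^sub>2" "\<pi>\<^sub>2 \<in> P\<^sub>2" "start G \<in> \<pi>\<^sub>2"
    by (rule fine.abs_start_block)
  obtain \<pi> where \<pi>: "\<pi> \<in> P\<^sub>1" "\<pi>\<^sub>2 \<subseteq> \<pi>" using exists_coarse_block[OF 2(2)] by (rule bexE)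
  have "\<pi> = \<pi>\<^sub>1" by (rule coarse.block_unique[OF \<pi>(1) 1(2) subsetD[OF \<pi>(2) 2(3)] 1(3)])
  then have "\<pi>\<^sub>2 \<subseteq> \<pi>\<^sub>1" using \<pi>(2) by simp
  then show thesis by (rule that[OF 1(1) 2(1) 1(2) 2(2)])
qed

end

theorem theorem3:
  fixes G :: "('s, 'a) game" and u :: "'s \<Rightarrow> real" and P\<^sub>1 P\<^sub>2 :: "'s set set"
    and c\<^sub>1 c\<^sub>2 d\<^sub>1 d\<^sub>2 :: "('s, 'a) abs_state \<Rightarrow> ('s, 'a) abs_act"
    and L :: nat
  assumes "concurrent_game G"
    and "partition_on (states G) P\<^sub>1"
    and "partition_on (states G) P\<^sub>2"
    and "refinement P\<^sub>2 P\<^sub>1"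
    and "abstractions_exist G P\<^sub>1"
    and "abstractions_exist G P\<^sub>2"
    and "dummy_choice G P\<^sub>1 c\<^sub>1"
    and "dummy_choice G P\<^sub>2 c\<^sub>2"
    and "dummy_choice G P\<^sub>1 d\<^sub>1"
    and "dummy_choice G P\<^sub>2 d\<^sub>2"
  shows "game_value (2 * L) (lower_abstraction G P\<^sub>1 c\<^sub>1) (lower_utility u)
           \<le> game_value (2 * L) (lower_abstraction G P\<^sub>2 c\<^sub>2) (lower_utility u)
       \<and> game_value (2 * L) (lower_abstraction G P\<^sub>2 c\<^sub>2) (lower_utility u)
           \<le> game_value (2 * L) (upper_abstraction G P\<^sub>2 d\<^sub>2) (upper_utility u)
       \<and> game_value (2 * L) (upper_abstraction G P\<^sub>2 d\<^sub>2) (upper_utility u)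
           \<le> game_value (2 * L) (upper_abstraction G P\<^sub>1 d\<^sub>1) (upper_utility u)"
proof -
  interpret refined_game G P\<^sub>1 P\<^sub>2
    using assms by unfold_locales
  obtain \<pi>\<^sub>1 \<pi>\<^sub>2 where start: "abs_start G P\<^sub>1 = Block \<pi>\<^sub>1" "abs_start G P\<^sub>2 = Block \<pi>\<^sub>2"
    and \<pi>: "\<pi>\<^sub>1 \<in> P\<^sub>1" "\<pi>\<^sub>2 \<in> P\<^sub>2" "\<pi>\<^sub>2 \<subseteq> \<pi>\<^sub>1"
    by (rule start_blocks)
  have lower: "start (lower_abstraction G P c) = abs_start G P"
    and upper: "start (upper_abstraction G P c) = abs_start G P" for P c
    by (simp_all add: lower_abstraction_def upper_abstraction_def)
  note value_eqs = game_value_eq_horizon_value[OF coarse.concurrent_game_lower[OF assms(7)]]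
    game_value_eq_horizon_value[OF fine.concurrent_game_lower[OF assms(8)]]
    game_value_eq_horizon_value[OF coarse.concurrent_game_upper[OF assms(9)]]
    game_value_eq_horizon_value[OF fine.concurrent_game_upper[OF assms(10)]]
  show ?thesis
    unfolding value_eqs lower upper start
    using horizon_value_lower_refine[OF \<pi>] fine.horizon_value_lower_le_upper[OF \<pi>(2)]
      horizon_value_upper_refine[OF \<pi>] by blast
qed

end
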